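(* Let $p\ge 2$ and let $u$ be an ancient solution of the half-space problem $u_t-\Delta u=|\nabla u|^p$ in $Q:=\mathbb{R}^n_+\times(-\infty,0)$, $u=0$ on $\partial\mathbb{R}^n_+\times(-\infty,0)$. Then: (i) $u\ge0$ in $Q$. (ii) If $p>2$, then, with $\beta=1/(p-1)$ and a constant $C=C(n,p)>0$, $$u(x,t)\le C\big(x_n^{1-\beta}+x_n^{1+\beta}|t|^{-\beta}\big)\quad\text{and}\quad |\nabla u(x,t)|\le C\big(x_n^{-\beta}+x_n^{\beta}|t|^{-\beta}\big)\qquad\text{for all }(x,t)\in Q.$$
   Context: $\mathbb{R}^n_+:=\{x\in\mathbb{R}^n: x_n>0\}$. An ancient solution of the half-space problem is a function $u\in C^{2,1}(Q)\cap C(\overline Q)$ satisfying the PDE pointwise in $Q$ and $u=0$ pointwise on $\partial\mathbb{R}^n_+\times(-\infty,0)$. *)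

theory Defs
  imports "HOL-Analysis.Analysis"
begin

text \<open>Space-time functions u x t with x in R^n (real^'n) and t in R.
 The distinguished coordinate k plays the role of x_n.\<close>

definition halfQ :: "'n::finite \<Rightarrow> ((real^'n) \<times> real) set" where
  "halfQ k = {(x, t). x $ k > 0 \<and> t < 0}"

definition pdx :: "(real^'n \<Rightarrow> real \<Rightarrow> real) \<Rightarrow> 'n::finite \<Rightarrow> real^'n \<Rightarrow> real \<Rightarrow> real" where
  "pdx u i x t = deriv (\<lambda>s. u (x + s *\<^sub>R axis i 1) t) 0"

definition pdt :: "(real^'n \<Rightarrow> real \<Rightarrow> real) \<Rightarrow> real^'n \<Rightarrow> real \<Rightarrow> real" where
  "pdt u x t = deriv (\<lambda>s. u x s) t"

definition sgrad :: "(real^'n \<Rightarrow> real \<Rightarrow> real) \<Rightarrow> real^'n \<Rightarrow> real \<Rightarrow> real^'n::finite" where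
  "sgrad u x t = (\<chi> i. pdx u i x t)"

definition slap :: "(real^'n \<Rightarrow> real \<Rightarrow> real) \<Rightarrow> real^'n::finite \<Rightarrow> real \<Rightarrow> real" where
  "slap u x t = (\<Sum>i\<in>UNIV. pdx (pdx u i) i x t)"

definition C21_on :: "((real^'n::finite) \<times> real) set \<Rightarrow> (real^'n \<Rightarrow> real \<Rightarrow> real) \<Rightarrow> bool" where
  "C21_on S u \<longleftrightarrow>
     (\<forall>(x,t)\<in>S. \<forall>i. (\<lambda>s. u (x + s *\<^sub>R axis i 1) t) differentiable (at 0)) \<and>
     (\<forall>(x,t)\<in>S. \<forall>i j. (\<lambda>s. pdx u i (x + s *\<^sub>R axis j 1) t) differentiable (at 0)) \<and>
     (\<forall>(x,t)\<in>S. (\<lambda>s. u x s) differentiable (at t)) \<and>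
     continuous_on S (\<lambda>(x,t). u x t) \<and>
     (\<forall>i. continuous_on S (\<lambda>(x,t). pdx u i x t)) \<and>
     (\<forall>i j. continuous_on S (\<lambda>(x,t). pdx (pdx u i) j x t)) \<and>
     continuous_on S (\<lambda>(x,t). pdt u x t)"

definition ancient_solution :: "'n::finite \<Rightarrow> real \<Rightarrow> (real^'n \<Rightarrow> real \<Rightarrow> real) \<Rightarrow> bool" where
  "ancient_solution k p u \<longleftrightarrow>
     C21_on (halfQ k) u \<and>
     continuous_on (closure (halfQ k)) (\<lambda>(x,t). u x t) \<and>
     (\<forall>(x,t)\<in>halfQ k. pdt u x t - slap u x t = norm (sgrad u x t) powr p) \<and>
     (\<forall>x t. x $ k = 0 \<and> t < 0 \<longrightarrow> u x t = 0)"

end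

theory Submission
  imports Defs "HOL-Real_Asymp.Real_Asymp"
begin

text \<open>All three bounds follow from the maximum principle on compact cylinders.

  Nonnegativity: since \<open>\<delta>\<^sup>p\<^sup>-\<^sup>2 q\<^sup>2 \<le> q\<^sup>p + \<delta>\<^sup>p\<close>, the Hopf-Cole transform \<open>exp (M u)\<close> with \<open>M = \<delta>\<^sup>p\<^sup>-\<^sup>2\<close> is a
  supersolution of \<open>w\<^sub>t - \<Delta>w + a\<^sup>2 w = 0\<close> for \<open>a = \<delta>\<^sup>p\<^sup>-\<^sup>1\<close>. It is positive and equals 1 on the boundary, so it
  dominates \<open>exp (- a x\<^sub>n)\<close>. Hence \<open>u \<ge> - \<delta> x\<^sub>n\<close>, and \<open>\<delta>\<close> is arbitrary.

  Upper bound: if \<open>u(y,s)\<close> is large, then a self-similar subsolution concentrated at \<open>(y,s)\<close>, corrected by a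
  multiple of \<open>x\<^sub>n\<^sup>1\<^sup>-\<^sup>\<beta>\<close> whose slope at the boundary is infinite, forces \<open>u\<close> to be positive on the boundary at a
  later negative time.

  Gradient bound: an interior Bernstein-type estimate for \<open>0 \<le> u \<le> M\<close>, obtained by doubling variables in
  \<open>- ln (2 M - u)\<close>. The upper bound supplies \<open>M\<close> on a cylinder of radius comparable to \<open>x\<^sub>n\<close>.\<close>

section \<open>Pointwise maximum tests\<close>

text \<open>No growth of \<open>u\<close> is prescribed for large |x| or as t -> -\<infinity>, so a
  comparison function must fall below every possible value of \<open>u\<close> on the outer walls by
  itself. Against exp(M u) it suffices to be negative there; once u \<ge> 0 is known, the same works
  against \<open>u\<close>, which is why nonnegativity precedes the upper bound. The exponents come
  from scaling. Since p/(p-1) = 1 + \<beta>, a multiple of -|X|^(1+\<beta>) \<tau>^(-\<beta>) is the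
  Hopf-Lax kernel of v_t = |grad v|^p; replacing |X|^2 by |X|^2 + b \<tau> smooths it at the
  parabolic scale, so that diffusion can be absorbed. The profile \<eta>(h) =
  h^(1-\<beta>)/(1-\<beta>) satisfies -\<eta>'' = \<beta> \<eta>'^p < \<eta>'^p, a strict stationary
  subsolution. For p > 2 it is finite at h = 0 with infinite slope, so the comparison needs no value
  of \<open>u\<close> on that face and instead yields one. For p = 2 one has \<beta> = 1 and this
  profile is lost.\<close>

lemma critical_point:
  fixes f :: "real \<Rightarrow> real"
  assumes "(f has_real_derivative D) (at 0)" "e > 0" "\<And>s. \<bar>s\<bar> < e \<Longrightarrow> f s \<le> f 0"
  shows "D = 0"
  using DERIV_local_max[of f D 0 e] assms by simp

text \<open>Used along single coordinate axes: summing the inequalities over \<open>i\<close>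
  produces the Laplacian, so mixed derivatives and total differentiability never enter.\<close>

lemma second_derivative_test:
  fixes f f' :: "real \<Rightarrow> real"
  assumes "e > 0"
    and d1: "\<And>s. \<bar>s\<bar> < e \<Longrightarrow> (f has_real_derivative f' s) (at s)"
    and d2: "(f' has_real_derivative D) (at 0)"
    and mx: "\<And>s. \<bar>s\<bar> < e \<Longrightarrow> f s \<le> f 0"
  shows "f' 0 = 0" "D \<le> 0"
proof -
  show z: "f' 0 = 0"
    using critical_point[OF d1 \<open>e > 0\<close> mx] \<open>e > 0\<close> by simp
  show "D \<le> 0"
  proof (rule ccontr)
    assume "\<not> D \<le> 0"
    then obtain c where c: "c > 0" "\<And>h. 0 < h \<Longrightarrow> h < c \<Longrightarrow> f' 0 < f' (0 + h)"
      using DERIV_pos_inc_right[OF d2] by auto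
    define h where "h = min c e / 2"
    have h: "0 < h" "h < c" "h < e" using c \<open>e > 0\<close> by (auto simp: h_def)
    obtain l where l: "0 < l" "l < h" "f h - f 0 = (h - 0) * f' l"
      using MVT2[of 0 h f f'] d1 h by fastforce
    have "f' l > 0" using c(2)[of l] l h z by auto
    then have "f h - f 0 > 0" using l h by auto
    with mx[of h] h show False by auto
  qed
qed

text \<open>One-sided, because the maximum over a closed time interval may sit at its final time,
  where only earlier times can be compared.\<close>

lemma left_derivative_test:
  fixes f :: "real \<Rightarrow> real"
  assumes d: "(f has_real_derivative D) (at t)" and "a < t"
    and mx: "\<And>s. a < s \<Longrightarrow> s < t \<Longrightarrow> f s \<le> f t"
  shows "D \<ge> 0"
proof (rule ccontr)
  assume "\<not> D \<ge> 0"
  then obtain c where c: "c > 0" "\<And>h. 0 < h \<Longrightarrow> h < c \<Longrightarrow> f t < f (t - h)"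
    using DERIV_neg_dec_left[OF d] by auto
  define h where "h = min c (t - a) / 2"
  have "0 < h" "h < c" "h < t - a" using c \<open>a < t\<close> by (auto simp: h_def)
  with c(2)[of h] mx[of "t - h"] show False by auto
qed

section \<open>Closure of the domain and shifts along coordinate axes\<close>

lemma closure_halfQ:
  "closure (halfQ k) = {(x::real^'n::finite, t). x $ k \<ge> 0 \<and> t \<le> 0}"
proof -
  have "halfQ k = {x::real^'n. axis k 1 \<bullet> x > 0} \<times> {..<0}"
    by (auto simp: halfQ_def inner_axis')
  moreover have "closure {x::real^'n. axis k 1 \<bullet> x > 0} = {x. axis k 1 \<bullet> x \<ge> 0}"
    by (intro closure_halfspace_gt) (simp add: axis_eq_0_iff)
  ultimately show ?thesis
    by (auto simp: closure_Times inner_axis')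
qed

lemma norm_sq_shift:
  fixes x y :: "real^'n::finite"
  shows "norm (x + s *\<^sub>R axis i 1 - y)^2 = norm (x - y)^2 + 2 * s * (x - y) $ i + s^2"
proof -
  have "x + s *\<^sub>R axis i 1 - y = (x - y) + s *\<^sub>R axis i 1" by simp
  then show ?thesis
    unfolding power2_norm_eq_inner
    by (simp add: inner_add_left inner_add_right inner_axis inner_axis' algebra_simps power2_eq_square inner_commute)
qed

lemma norm_shift_le:
  fixes x y :: "real^'n::finite"
  shows "norm (x + s *\<^sub>R axis i 1 - y) \<le> norm (x - y) + \<bar>s\<bar>"
proof -
  have "norm ((x - y) + s *\<^sub>R axis i 1) \<le> norm (x - y) + norm (s *\<^sub>R axis i (1::real) :: real^'n)"
    by (rule norm_triangle_ineq)
  then show ?thesis by (simp add: algebra_simps)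
qed

lemma norm_sq_sum: "norm (x::real^'n::finite)^2 = (\<Sum>i\<in>UNIV. (x $ i)^2)"
  by (simp add: norm_vec_def L2_set_def sum_nonneg)

lemma shift_nth: "(x + s *\<^sub>R axis i (1::real)) $ k = x $ k + (if i = k then s else 0)"
  by (simp add: axis_def)

section \<open>Real inequalities\<close>

lemma powr_split2:
  fixes x p :: real
  assumes "x \<ge> 0" "p \<ge> 2"
  shows "x powr p = x powr (p - 2) * x^2"
proof (cases "x = 0")
  case False
  then have "x^2 = x powr 2" using assms by (simp add: powr_numeral)
  moreover have "x powr (p - 2) * x powr 2 = x powr p" by (simp flip: powr_add)
  ultimately show ?thesis by simp
qed (use assms in auto)

text \<open>Both A and B are at most N, so N^(p-2) can be split off and only squares remain. This
  bounds |grad \<phi>|^p from below by the sum of the p-th powers of two gradient parts with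
  nonnegative inner product.\<close>

lemma powr_superadditive_sq:
  fixes A B N p :: real
  assumes "p \<ge> 2" "A \<ge> 0" "B \<ge> 0" "N \<ge> 0" "A^2 + B^2 \<le> N^2"
  shows "A powr p + B powr p \<le> N powr p"
proof -
  have AN: "A \<le> N" and BN: "B \<le> N" using assms
    by (smt (verit) power2_le_imp_le zero_le_power2)+
  have "A powr p + B powr p = A powr (p - 2) * A^2 + B powr (p - 2) * B^2"
    using assms by (simp add: powr_split2)
  also have "\<dots> \<le> N powr (p - 2) * A^2 + N powr (p - 2) * B^2"
    using AN BN assms by (intro add_mono mult_right_mono powr_mono2) auto
  also have "\<dots> = N powr (p - 2) * (A^2 + B^2)" by (simp add: algebra_simps)
  also have "\<dots> \<le> N powr (p - 2) * N^2" using assms by (intro mult_left_mono) auto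
  also have "\<dots> = N powr p" using assms by (simp add: powr_split2)
  finally show ?thesis .
qed

text \<open>At a maximum of the doubled function, \<open>a\<close> and \<xi> are the gradient norms
  of -ln w at x and y, \<zeta> is the cutoff and L = ln wy - ln wx. The equation for -ln w has
  right-hand side w^(p-1) |q|^p - |q|^2. Passing from y to x gains the factor exp(-(p-1) L) through
  w; the errors are also of order L, but relatively small for large A.\<close>

lemma doubling_core:
  fixes \<xi> \<zeta> R A n L wx wy M a p :: real
  assumes p: "p \<ge> 2" and R: "R > 0" and \<zeta>: "0 < \<zeta>" "\<zeta> \<le> R^2" and n: "n \<ge> 0" and A: "A = 32 + 8 * n"
    and \<xi>: "\<xi> * \<zeta> = A * R" and L: "0 < L" "L \<le> 1" and M: "M > 0" "M \<le> wy" and wx: "wx = wy * exp (- L)"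
    and MR: "R powr (p - 2) \<le> M powr (p - 1)"
    and a: "0 \<le> a" "a \<le> \<xi> + 2 * L * R / \<zeta>" "\<xi> - 2 * L * R / \<zeta> \<le> a"
  shows "\<zeta> * (wx powr (p - 1) * a powr p - wy powr (p - 1) * \<xi> powr p - a^2 + \<xi>^2) + (2 * n + 1) * L + 8 * L * R^2 / \<zeta> < 0"
proof -
  have A0: "A \<ge> 32" using A n by simp
  have \<xi>eq: "\<xi> = A * R / \<zeta>" using \<xi> \<zeta> by (simp add: field_simps)
  have \<xi>0: "\<xi> > 0" using \<xi>eq A0 R \<zeta> by simp
  have q: "2 * L * R / \<zeta> = 2 * L / A * \<xi>" using A0 by (simp add: \<xi>eq)
  define W where "W = wy powr (p - 1) * \<xi> powr p"
  have W0: "W \<ge> 0" by (simp add: W_def)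
  have ap: "a powr p \<le> \<xi> powr p * exp ((p - 1) * L / 2)"
  proof -
    have "a \<le> \<xi> * (1 + 2 * L / A)" using a(2) unfolding q by (simp add: algebra_simps)
    also have "\<dots> \<le> \<xi> * exp (2 * L / A)" using \<xi>0 exp_ge_add_one_self by (intro mult_left_mono) auto
    finally have "a powr p \<le> (\<xi> * exp (2 * L / A)) powr p" using a p by (intro powr_mono2) auto
    also have "\<dots> = \<xi> powr p * exp (p * (2 * L / A))" using \<xi>0 by (simp add: powr_mult exp_powr_real mult.commute)
    \<comment> \<open>A \<ge> 32 keeps the growth of the p-th power of the gradient within half of
      the gain (p - 1) L.\<close>
    also have "\<dots> \<le> \<xi> powr p * exp ((p - 1) * L / 2)"
    proof -
      have "p * (2 * L / A) \<le> p * (2 * L / 32)" using A0 L p by (intro mult_left_mono divide_left_mono) auto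
      also have "\<dots> = p / 8 * (L / 2)" by simp
      also have "\<dots> \<le> (p - 1) * (L / 2)" using p L by (intro mult_right_mono) auto
      finally show ?thesis by (intro mult_left_mono) auto
    qed
    finally show ?thesis .
  qed
  have "wx powr (p - 1) * a powr p \<le> wx powr (p - 1) * (\<xi> powr p * exp ((p - 1) * L / 2))"
    using ap by (intro mult_left_mono) auto
  also have "\<dots> = W * exp (- ((p - 1) * L / 2))"
  proof -
    have wxe: "wx powr (p - 1) = wy powr (p - 1) * exp (- ((p - 1) * L))"
      using M by (simp add: wx powr_mult exp_powr_real mult.commute)
    have "exp (- ((p - 1) * L)) * exp ((p - 1) * L / 2) = exp (- ((p - 1) * L / 2))"
      by (simp flip: exp_add)
    then show ?thesis unfolding W_def wxe by (simp add: mult_ac)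
  qed
  also have "\<dots> \<le> W * exp (- (L / 2))"
  proof -
    have "1 * (L / 2) \<le> (p - 1) * (L / 2)" using p L by (intro mult_right_mono) auto
    then show ?thesis using W0 by (intro mult_left_mono) auto
  qed
  also have "\<dots> \<le> W * (1 - L / 4)"
  proof -
    have "1 \<le> (1 - L / 4) * (1 + L / 2)" using L mult_left_mono[of L 1 L] by (simp add: algebra_simps)
    also have "\<dots> \<le> (1 - L / 4) * exp (L / 2)" using L exp_ge_add_one_self by (intro mult_left_mono) auto
    finally have "exp (- (L / 2)) \<le> 1 - L / 4" by (simp add: exp_minus field_simps)
    then show ?thesis using W0 by (intro mult_left_mono) auto
  qed
  finally have 1: "wx powr (p - 1) * a powr p - W \<le> - (W * L / 4)" by (simp add: algebra_simps)
  \<comment> \<open>Here \<open>MR\<close> enters: together with \<xi> \<ge> 1/R it gives wy^(p-1)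
    \<xi>^(p-2) \<ge> 1, so the nonlinear term dominates the quadratic one created by the
    logarithm.\<close>
  have W\<xi>: "W \<ge> \<xi>^2"
  proof -
    have "1 / R \<le> \<xi>"
    proof -
      have "\<zeta> \<le> A * R * R"
      proof -
        have "1 * R^2 \<le> A * R^2" using A0 by (intro mult_right_mono) auto
        then show ?thesis using \<zeta> by (simp add: power2_eq_square mult_ac)
      qed
      then show ?thesis unfolding \<xi>eq using R \<zeta> by (simp add: field_simps)
    qed
    then have "(1 / R) powr (p - 2) \<le> \<xi> powr (p - 2)" using p R by (intro powr_mono2) auto
    moreover have "R powr (p - 2) \<le> wy powr (p - 1)"
      using MR M p powr_mono2[of "p - 1" M wy] by auto
    ultimately have "R powr (p - 2) * (1 / R) powr (p - 2) \<le> wy powr (p - 1) * \<xi> powr (p - 2)"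
      by (intro mult_mono) auto
    moreover have "R powr (p - 2) * (1 / R) powr (p - 2) = 1" using R by (simp flip: powr_mult)
    ultimately have "1 * \<xi>^2 \<le> wy powr (p - 1) * \<xi> powr (p - 2) * \<xi>^2" by (intro mult_right_mono) auto
    then show ?thesis unfolding W_def using powr_split2[of \<xi> p] \<xi>0 p by (simp add: mult_ac)
  qed
  have 2: "\<xi>^2 - a^2 \<le> 4 * L * \<xi>^2 / A"
  proof (cases "a \<le> \<xi>")
    case True
    have "\<xi>^2 - a^2 = (\<xi> - a) * (\<xi> + a)" by (simp add: power2_eq_square algebra_simps)
    also have "\<dots> \<le> (2 * L / A * \<xi>) * (2 * \<xi>)"
      using a(3) True \<xi>0 A0 L a(1) unfolding q by (intro mult_mono) auto
    finally show ?thesis by (simp add: power2_eq_square mult_ac)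
  next
    case False
    then have "\<xi>^2 \<le> a^2" using \<xi>0 by (intro power_mono) auto
    moreover have "4 * L * \<xi>^2 / A \<ge> 0" using L A0 by simp
    ultimately show ?thesis by linarith
  qed
  have "\<xi>^2 * L / 4 \<le> W * L / 4" using W\<xi> L by (intro divide_right_mono mult_right_mono) auto
  then have "wx powr (p - 1) * a powr p - W - a^2 + \<xi>^2 \<le> - (\<xi>^2 * L / 4) + 4 * L * \<xi>^2 / A"
    using 1 2 by linarith
  also have "\<dots> = - (L * \<xi>^2 * (1 / 4 - 4 / A))" by (simp add: algebra_simps)
  finally have "\<zeta> * (wx powr (p - 1) * a powr p - W - a^2 + \<xi>^2) \<le> \<zeta> * - (L * \<xi>^2 * (1 / 4 - 4 / A))"
    using \<zeta> by (intro mult_left_mono) auto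
  \<comment> \<open>The choice of A makes A/4 - 4 = 4 + 2 n. In units of L R^2 / \<zeta> the gain is
    at least 32 (4 + 2 n), against 2 n + 9 from the remaining terms; \<zeta> \<le> R^2 puts (2 n +
    1) L into the same units.\<close>
  also have "\<dots> = - (L * R^2 / \<zeta> * (A * (4 + 2 * n)))"
  proof -
    have "\<zeta> * \<xi>^2 = A^2 * R^2 / \<zeta>" using \<zeta> by (simp add: \<xi>eq power2_eq_square)
    moreover have "\<zeta> * - (L * \<xi>^2 * c) = - (L * c * (\<zeta> * \<xi>^2))" for c by simp
    ultimately have "\<zeta> * - (L * \<xi>^2 * (1 / 4 - 4 / A)) = - (L * R^2 / \<zeta> * (A^2 * (1 / 4 - 4 / A)))"
      by simp
    also have "A^2 * (1 / 4 - 4 / A) = A * (A / 4 - 4)" using A0 by (simp add: power2_eq_square field_simps)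
    also have "A / 4 - 4 = 4 + 2 * n" by (simp add: A)
    finally show ?thesis .
  qed
  also have "\<dots> < - (L * R^2 / \<zeta> * (2 * n + 9))"
  proof -
    have "2 * n + 9 < 32 * (4 + 2 * n)" using n by simp
    also have "\<dots> \<le> A * (4 + 2 * n)" using A0 n by (intro mult_right_mono) auto
    finally have "L * R^2 / \<zeta> * (2 * n + 9) < L * R^2 / \<zeta> * (A * (4 + 2 * n))"
      using L R \<zeta> by (intro mult_strict_left_mono) auto
    then show ?thesis by simp
  qed
  also have "(2 * n + 1) * L \<le> (2 * n + 1) * (L * R^2 / \<zeta>)"
    using \<zeta> L n by (intro mult_left_mono) (auto simp: field_simps)
  ultimately have "\<zeta> * (wx powr (p - 1) * a powr p - W - a^2 + \<xi>^2) + (2 * n + 1) * L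
      < - (L * R^2 / \<zeta> * (2 * n + 9)) + (2 * n + 1) * (L * R^2 / \<zeta>)" by linarith
  moreover have "- (L * R^2 / \<zeta> * (2 * n + 9)) + (2 * n + 1) * (L * R^2 / \<zeta>) = - (8 * (L * R^2 / \<zeta>))"
    by algebra
  moreover have "8 * (L * R^2 / \<zeta>) = 8 * L * R^2 / \<zeta>" by simp
  ultimately show ?thesis unfolding W_def by linarith
qed

text \<open>The parameters stand for \<open>\<theta> = \<bar>X\<bar>\<^sup>2 / P\<close>, \<open>Y = \<tau>\<^sup>-\<^sup>\<beta> P\<^bsup>\<beta>/2\<^esup>\<close>, \<open>g = h\<^sup>-\<^sup>\<beta>\<close> with \<open>P = \<bar>X\<bar>\<^sup>2 + b \<tau>\<close>, and \<open>N\<close> for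
  the norm of the gradient. For small \<open>\<theta>\<close> the left-hand side is negative up to the last term because
  \<open>\<beta> < \<gamma>\<close>; otherwise a large \<open>a\<close> makes the gradient dominate.\<close>
lemma barrier_constants:
  fixes p \<beta> \<gamma> n :: real
  assumes p: "p > 2" and \<beta>: "\<beta> = 1 / (p - 1)" and \<gamma>: "\<gamma> = (1 + \<beta>) / 2" and n: "n \<ge> 1"
  shows "\<exists>a b. a > 0 \<and> b \<ge> 1 \<and> (\<forall>\<theta> Y g N. 0 \<le> \<theta> \<longrightarrow> \<theta> \<le> 1 \<longrightarrow> Y > 0 \<longrightarrow> g > 0 \<longrightarrow> N \<ge> 0 \<longrightarrow>
     ((2 * a * \<gamma> * sqrt \<theta> * Y)^2 + g^2 \<le> N^2 \<or> g \<le> Y \<and> 2 * a * \<gamma> * sqrt \<theta> * Y - g \<le> N) \<longrightarrow>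
     a * Y powr p * (\<beta> - \<gamma> * (1 - 2 * n / b) * (1 - \<theta>)) + \<beta> * g powr p < N powr p)"
proof -
  have b01: "0 < \<beta>" "\<beta> < 1" using p by (auto simp: \<beta>)
  have g01: "\<beta> < \<gamma>" "\<gamma> < 1" "0 < \<gamma>" using b01 by (auto simp: \<gamma>)
  \<comment> \<open>\<open>b\<close> makes the Laplacian correction 2 n \<gamma> / b equal to
    \<delta>, a quarter of the gap \<gamma> - \<beta>. The summands of \<open>a\<close> give a e^2
    \<ge> 2, a \<delta> > 1 and a > 2. For \<theta> \<ge> \<delta> the gradient of the first barrier
    term is at least 2 a e Y, and (a e)^p \<ge> a (a e^2) > a + 1.\<close>
  define \<delta> where "\<delta> = (\<gamma> - \<beta>) / 4"
  define b where "b = 8 * n * \<gamma> / (\<gamma> - \<beta>)"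
  define e where "e = \<gamma> * sqrt \<delta>"
  define a where "a = 2 / e^2 + 2 / \<delta> + 2"
  have d: "0 < \<delta>" "\<delta> < 1" using g01 b01 by (auto simp: \<delta>_def)
  have e: "0 < e" "e < 1"
  proof -
    show "0 < e" using d g01 by (simp add: e_def)
    have "sqrt \<delta> < 1" using d by simp
    then have "\<gamma> * sqrt \<delta> < 1 * 1" using d g01 by (intro mult_strict_mono) auto
    then show "e < 1" by (simp add: e_def)
  qed
  have b: "b \<ge> 1"
  proof -
    have "\<gamma> - \<beta> \<le> 8 * n * \<gamma>"
    proof -
      have "1 * \<gamma> \<le> 8 * n * \<gamma>" using n g01 by (intro mult_right_mono) auto
      then show ?thesis using b01 by simp
    qed
    then show ?thesis using g01 by (simp add: b_def)
  qed
  have \<kappa>: "\<gamma> * (1 - 2 * n / b) = \<gamma> - \<delta>"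
    using g01 n by (simp add: b_def \<delta>_def field_simps)
  have a2: "a > 2" using d e by (simp add: a_def add_pos_pos)
  have ad: "a * \<delta> > 1"
  proof -
    have "2 / \<delta> * \<delta> < a * \<delta>" using d e by (intro mult_strict_right_mono) (auto simp: a_def add_pos_pos)
    then show ?thesis using d by simp
  qed
  have ae: "a * e^2 \<ge> 2"
  proof -
    have "2 / e^2 * e^2 \<le> a * e^2" using d e by (intro mult_right_mono) (auto simp: a_def)
    then show ?thesis using e by simp
  qed
  have ae1: "a * e \<ge> 1"
  proof -
    have "a * e^2 \<le> a * e" using a2 e by (intro mult_left_mono) (auto simp: power2_eq_square)
    then show ?thesis using ae by linarith
  qed
  have aep: "(a * e) powr p > a + 1"
  proof -
    have "a + 1 < a * 2" using a2 by simp
    also have "\<dots> \<le> a * (a * e^2)" using ae a2 by (intro mult_left_mono) auto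
    also have "\<dots> = (a * e) powr 2" using a2 e by (simp add: powr_numeral power2_eq_square)
    also have "\<dots> \<le> (a * e) powr p" using ae1 p by (intro powr_mono) auto
    finally show ?thesis .
  qed
  show ?thesis
  proof (rule exI[of _ a], rule exI[of _ b], intro conjI allI impI)
    show "a > 0" "b \<ge> 1" using a2 b by auto
    fix \<theta> Y g N :: real
    assume t: "0 \<le> \<theta>" "\<theta> \<le> 1" and Y: "Y > 0" and g: "g > 0" and N: "N \<ge> 0"
      and H: "(2 * a * \<gamma> * sqrt \<theta> * Y)^2 + g^2 \<le> N^2 \<or> g \<le> Y \<and> 2 * a * \<gamma> * sqrt \<theta> * Y - g \<le> N"
    define br where "br = \<beta> - \<gamma> * (1 - 2 * n / b) * (1 - \<theta>)"
    have brle: "br \<le> \<beta>" unfolding br_def \<kappa> using t g01 d b01 by (simp add: \<delta>_def)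
    have Yp: "Y powr p > 0" using Y by simp
    have small: "br \<le> - \<delta>" if "\<theta> < \<delta>"
    proof -
      have "(\<gamma> - \<delta>) * \<theta> \<le> 1 * \<theta>" using g01 d t by (intro mult_right_mono) auto
      then have "(\<gamma> - \<delta>) * \<theta> \<le> \<delta>" using that by simp
      moreover have "\<gamma> - \<beta> = 4 * \<delta>" by (simp add: \<delta>_def)
      moreover have "br = \<beta> - \<gamma> + \<delta> + (\<gamma> - \<delta>) * \<theta>"
        unfolding br_def \<kappa> by (simp add: algebra_simps)
      ultimately show ?thesis using d by linarith
    qed
    have big: "a * e \<le> a * \<gamma> * sqrt \<theta>" if "\<theta> \<ge> \<delta>"
      unfolding e_def using that a2 g01 by simp
    have gp: "\<beta> * g powr p \<le> g powr p" using b01 g by simp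
    have "a * Y powr p * br + \<beta> * g powr p < N powr p"
      using H
    proof
      assume H1: "(2 * a * \<gamma> * sqrt \<theta> * Y)^2 + g^2 \<le> N^2"
      have sup: "(2 * a * \<gamma> * sqrt \<theta> * Y) powr p + g powr p \<le> N powr p"
        using H1 p a2 g01 t Y g N by (intro powr_superadditive_sq) auto
      have "a * Y powr p * br < (2 * a * \<gamma> * sqrt \<theta> * Y) powr p"
      proof (cases "\<theta> < \<delta>")
        case True
        then have "a * Y powr p * br < 0"
          using small a2 Yp d by (intro mult_pos_neg) auto
        then show ?thesis by (smt (verit) powr_ge_zero)
      next
        case False
        have "a * Y powr p * br \<le> a * Y powr p * 1"
          using brle b01 a2 Yp by (intro mult_left_mono) auto
        also have "\<dots> < (a * e) powr p * Y powr p" using aep Yp by simp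
        also have "\<dots> = (a * e * Y) powr p" using a2 e Y by (simp add: powr_mult)
        also have "\<dots> \<le> (2 * a * \<gamma> * sqrt \<theta> * Y) powr p"
        proof (intro powr_mono2 mult_right_mono)
          have "a * \<gamma> * sqrt \<theta> \<ge> 0" using a2 g01 t by simp
          then show "a * e \<le> 2 * a * \<gamma> * sqrt \<theta>" using big False by linarith
        qed (use a2 e Y p in auto)
        finally show ?thesis .
      qed
      then show ?thesis using sup gp by linarith
    next
      \<comment> \<open>The two gradients may now cancel in part. For \<theta> \<ge> \<delta> the
        loss g \<le> Y is paid by the factor 2 in 2 a e Y, as a e \<ge> 1; for \<theta> < \<delta>
        the condition a \<delta> > 1 absorbs the boundary term.\<close>
      assume H2: "g \<le> Y \<and> 2 * a * \<gamma> * sqrt \<theta> * Y - g \<le> N"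
      have gY: "\<beta> * g powr p \<le> Y powr p"
        using H2 g p gp powr_mono2[of p g Y] by linarith
      show ?thesis
      proof (cases "\<theta> < \<delta>")
        case True
        then have "a * Y powr p * br \<le> a * Y powr p * (- \<delta>)"
          using small a2 Yp by (intro mult_left_mono) auto
        also have "\<dots> = - (a * \<delta>) * Y powr p" by simp
        also have "\<dots> < - 1 * Y powr p" using ad Yp by (intro mult_strict_right_mono) auto
        finally show ?thesis using gY by (smt (verit) powr_ge_zero)
      next
        case False
        have "a * e * Y \<le> N"
        proof -
          have "1 * Y \<le> (a * e) * Y" using ae1 Y by (intro mult_right_mono) auto
          moreover have "(a * e) * Y \<le> (a * \<gamma> * sqrt \<theta>) * Y"
            using big False Y by (intro mult_right_mono) auto
          ultimately show ?thesis using H2 by (simp add: algebra_simps)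
        qed
        then have N1: "(a * e) powr p * Y powr p \<le> N powr p"
          using a2 e Y p powr_mono2[of p "a * e * Y" N] by (simp add: powr_mult)
        have "a * Y powr p * br \<le> a * Y powr p * 1"
          using brle b01 a2 Yp by (intro mult_left_mono) auto
        then have "a * Y powr p * br + \<beta> * g powr p \<le> (a + 1) * Y powr p"
          using gY by (simp add: algebra_simps)
        also have "\<dots> < (a * e) powr p * Y powr p" using aep Yp by simp
        finally show ?thesis using N1 by linarith
      qed
    qed
    then show "a * Y powr p * (\<beta> - \<gamma> * (1 - 2 * n / b) * (1 - \<theta>)) + \<beta> * g powr p < N powr p"
      unfolding br_def .
  qed
qed

text \<open>\<open>barrier_ok\<close> says that \<open>\<phi> = N - a \<tau>\<^sup>-\<^sup>\<beta> (\<bar>X\<bar>\<^sup>2 + b \<tau>)\<^sup>\<gamma> + h\<^sup>1\<^sup>-\<^sup>\<beta> / (1 - \<beta>)\<close> satisfies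
  \<open>\<phi>\<^sub>t - \<Delta>\<phi> < \<bar>\<nabla>\<phi>\<bar>\<^sup>p\<close> for \<open>0 < \<tau> \<le> d\<^sup>2\<close>, where \<open>X = x - y\<close>, \<open>\<tau> = t - s\<close>, and \<open>h\<close>, \<open>d\<close> are the
  heights of \<open>x\<close>, \<open>y\<close> above a hyperplane parallel to the boundary.\<close>
definition barrier_ok :: "'n::finite \<Rightarrow> real \<Rightarrow> real \<Rightarrow> real \<Rightarrow> real \<Rightarrow> bool" where
  "barrier_ok k p \<beta> a b \<longleftrightarrow> (\<forall>(X::real^'n) \<tau> d h.
     d > 0 \<longrightarrow> \<tau> > 0 \<longrightarrow> \<tau> \<le> d^2 \<longrightarrow> h > 0 \<longrightarrow> X $ k = h - d \<longrightarrow>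
     (let \<gamma> = (1 + \<beta>) / 2; P = norm X^2 + b * \<tau> in
      a * \<beta> * \<tau> powr (- \<beta> - 1) * P powr \<gamma> - a * \<tau> powr (- \<beta>) * \<gamma> * P powr (\<gamma> - 1) * b
      + (a * \<tau> powr (- \<beta>) * (\<gamma> * (\<gamma> - 1) * P powr (\<gamma> - 2) * (4 * norm X^2) + 2 * real CARD('n) * \<gamma> * P powr (\<gamma> - 1))
      + \<beta> * h powr (- \<beta> - 1))
      < norm (\<chi> i. (if i = k then h powr (- \<beta>) else 0) - 2 * a * \<tau> powr (- \<beta>) * \<gamma> * P powr (\<gamma> - 1) * X $ i) powr p))"

text \<open>The identity \<beta> p = 1 + \<beta> gives the competing terms the same homogeneity:
  \<open>Y powr p = S\<close> and \<open>g powr p = h powr (- \<beta> - 1)\<close>. What remains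
  depends only on \<theta>, Y, g and the gradient norm, hence one pair a, b serves all points and
  times.\<close>

lemma barrier_ok_exists:
  fixes p \<beta> :: real and k :: "'n::finite"
  assumes p: "p > 2" and \<beta>: "\<beta> = 1 / (p - 1)"
  shows "\<exists>a>0. \<exists>b>0. barrier_ok k p \<beta> a b"
proof -
  let ?n = "real CARD('n)"
  define \<gamma> where "\<gamma> = (1 + \<beta>) / 2"
  have "?n \<ge> 1" using card_gt_0_iff[of "UNIV::'n set"] by (simp add: Suc_le_eq)
  then obtain a b where a: "a > 0" and b: "b \<ge> 1" and core: "\<And>\<theta> Y g N. 0 \<le> \<theta> \<Longrightarrow> \<theta> \<le> 1 \<Longrightarrow> Y > 0 \<Longrightarrow> g > 0 \<Longrightarrow> N \<ge> 0 \<Longrightarrow>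
     ((2 * a * \<gamma> * sqrt \<theta> * Y)^2 + g^2 \<le> N^2 \<or> g \<le> Y \<and> 2 * a * \<gamma> * sqrt \<theta> * Y - g \<le> N) \<Longrightarrow>
     a * Y powr p * (\<beta> - \<gamma> * (1 - 2 * ?n / b) * (1 - \<theta>)) + \<beta> * g powr p < N powr p"
    using barrier_constants[OF p \<beta> \<gamma>_def, of ?n] by metis
  have b01: "0 < \<beta>" "\<beta> < 1" using p by (auto simp: \<beta>)
  have g01: "\<beta> < \<gamma>" "\<gamma> < 1" "0 < \<gamma>" using b01 by (auto simp: \<gamma>_def)
  have bp: "\<beta> * p = 1 + \<beta>" using p by (simp add: \<beta> field_simps)
  have "barrier_ok k p \<beta> a b"
    unfolding barrier_ok_def
  proof (intro allI impI)
    fix X :: "real^'n" and \<tau> d h :: real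
    assume d: "d > 0" and \<tau>: "\<tau> > 0" "\<tau> \<le> d^2" and h: "h > 0" and Xk: "X $ k = h - d"
    define P where "P = norm X^2 + b * \<tau>"
    define S where "S = \<tau> powr (- \<beta> - 1) * P powr \<gamma>"
    define Y where "Y = \<tau> powr (- \<beta>) * P powr (\<beta> / 2)"
    define \<theta> where "\<theta> = norm X^2 / P"
    define g where "g = h powr (- \<beta>)"
    define c where "c = 2 * a * \<tau> powr (- \<beta>) * \<gamma> * P powr (\<gamma> - 1)"
    define G where "G = (\<chi> i. (if i = k then g else 0) - c * X $ i)"
    have bt: "b * \<tau> > 0" using b \<tau> by simp
    have P: "P > 0" using bt by (simp add: P_def add_nonneg_pos)
    have Pt: "P \<ge> \<tau>"
    proof -
      have "1 * \<tau> \<le> b * \<tau>" using b \<tau> by (intro mult_right_mono) auto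
      then show ?thesis unfolding P_def by (smt (verit) zero_le_power2)
    qed
    have \<theta>: "0 \<le> \<theta>" "\<theta> \<le> 1" using P bt by (auto simp: \<theta>_def P_def)
    have Y: "Y > 0" using \<tau> P by (simp add: Y_def)
    have g: "g > 0" using h by (simp add: g_def)
    have c: "c > 0" using a \<tau> P g01 by (simp add: c_def)
    have YS: "Y powr p = S"
    proof -
      have "Y powr p = \<tau> powr (- (\<beta> * p)) * P powr (\<beta> * p / 2)"
        using \<tau> P by (simp add: Y_def powr_mult powr_powr)
      moreover have e: "- (1 + \<beta>) = - \<beta> - 1" by simp
      ultimately show ?thesis unfolding bp S_def \<gamma>_def e by blast
    qed
    have gp: "g powr p = h powr (- \<beta> - 1)"
    proof -
      have "g powr p = h powr (- (\<beta> * p))" by (simp add: g_def powr_powr)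
      moreover have e: "- (1 + \<beta>) = - \<beta> - 1" by simp
      ultimately show ?thesis unfolding bp e by blast
    qed
    have tP: "\<tau> powr (- \<beta>) * P powr (\<gamma> - 1) = S * (\<tau> / P)"
      using \<tau> P by (simp add: S_def powr_diff)
    have cX: "c * norm X = 2 * a * \<gamma> * sqrt \<theta> * Y"
    proof -
      have "sqrt \<theta> = norm X / sqrt P" by (simp add: \<theta>_def real_sqrt_divide)
      moreover have "P powr (\<gamma> - 1) = P powr (\<beta> / 2) / sqrt P"
      proof -
        have "P powr (\<gamma> - 1) = P powr (\<beta> / 2 - 1 / 2)" by (simp add: \<gamma>_def field_simps)
        then show ?thesis using P by (simp add: powr_diff powr_half_sqrt)
      qed
      ultimately show ?thesis by (simp add: c_def Y_def)
    qed
    have G2: "norm G^2 = (c * norm X)^2 - 2 * c * g * X $ k + g^2"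
    proof -
      have Geq: "G = g *\<^sub>R axis k 1 - c *\<^sub>R X"
        by (auto simp: G_def vec_eq_iff axis_def)
      show ?thesis
        unfolding Geq power_mult_distrib unfolding power2_norm_eq_inner
        by (simp add: inner_diff_left inner_diff_right inner_axis inner_axis' power2_eq_square inner_commute algebra_simps)
    qed
    have H: "(2 * a * \<gamma> * sqrt \<theta> * Y)^2 + g^2 \<le> norm G^2 \<or> g \<le> Y \<and> 2 * a * \<gamma> * sqrt \<theta> * Y - g \<le> norm G"
    proof (cases "h \<le> d")
      case True
      then have "c * g * X $ k \<le> 0" using c g Xk by (intro mult_nonneg_nonpos) auto
      then show ?thesis using G2 cX by simp
    next
      case False
      \<comment> \<open>Only above height d can the gradients oppose each other, and there \<tau>
        \<le> d^2 makes the boundary gradient the smaller one: h^(-\<beta>) \<le>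
        \<tau>^(-\<beta>/2) \<le> Y.\<close>
      have "g \<le> d powr (- \<beta>)" unfolding g_def using False d b01 by (intro powr_mono2') auto
      also have "\<dots> = (d^2) powr (- (\<beta> / 2))" using d by (simp add: powr_powr flip: powr_numeral)
      also have "\<dots> \<le> \<tau> powr (- (\<beta> / 2))" using \<tau> b01 d by (intro powr_mono2') auto
      also have "\<dots> = \<tau> powr (- \<beta>) * \<tau> powr (\<beta> / 2)" by (simp flip: powr_add)
      also have "\<dots> \<le> Y" unfolding Y_def using \<tau> Pt b01 by (intro mult_left_mono powr_mono2) auto
      finally have gY: "g \<le> Y" .
      have "(c * norm X - g)^2 \<le> norm G^2"
      proof -
        have "c * g * X $ k \<le> c * g * norm X"
          using c g component_le_norm_cart[of X k] by (intro mult_left_mono) auto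
        then show ?thesis unfolding G2 by (simp add: power2_eq_square algebra_simps)
      qed
      then have "c * norm X - g \<le> norm G" using power2_le_imp_le norm_ge_zero by blast
      then show ?thesis using gY cX by simp
    qed
    have main: "a * S * (\<beta> - \<gamma> * (1 - 2 * ?n / b) * (1 - \<theta>)) + \<beta> * h powr (- \<beta> - 1) < norm G powr p"
      using core[OF \<theta> Y g norm_ge_zero H] by (simp add: YS gp)
    have X2: "norm X^2 = P - b * \<tau>" by (simp add: P_def)
    have "1 - \<theta> = b * \<tau> / P" unfolding \<theta>_def X2 using P by (simp add: diff_divide_distrib)
    then have th: "\<tau> / P = (1 - \<theta>) / b" using b by simp
    \<comment> \<open>This part of the Laplacian has the favourable sign because \<gamma> < 1, and
      is discarded.\<close>
    have "a * \<tau> powr (- \<beta>) * (\<gamma> * (\<gamma> - 1) * P powr (\<gamma> - 2) * (4 * norm X^2)) \<le> 0"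
      using a g01 by (intro mult_nonneg_nonpos mult_nonpos_nonneg) auto
    moreover have "a * \<beta> * S - a * (S * (\<tau> / P)) * \<gamma> * b + a * (S * (\<tau> / P)) * (2 * ?n * \<gamma>)
       = a * S * (\<beta> - \<gamma> * (1 - 2 * ?n / b) * (1 - \<theta>))"
      unfolding th using b by (simp add: field_simps)
    ultimately have "a * \<beta> * S - a * (\<tau> powr (- \<beta>) * P powr (\<gamma> - 1)) * \<gamma> * b
       + a * \<tau> powr (- \<beta>) * (\<gamma> * (\<gamma> - 1) * P powr (\<gamma> - 2) * (4 * norm X^2))
       + a * (\<tau> powr (- \<beta>) * P powr (\<gamma> - 1)) * (2 * ?n * \<gamma>) + \<beta> * h powr (- \<beta> - 1) < norm G powr p"
      using main unfolding tP by linarith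
    then show "let \<gamma> = (1 + \<beta>) / 2; P = norm X^2 + b * \<tau> in
      a * \<beta> * \<tau> powr (- \<beta> - 1) * P powr \<gamma> - a * \<tau> powr (- \<beta>) * \<gamma> * P powr (\<gamma> - 1) * b
      + (a * \<tau> powr (- \<beta>) * (\<gamma> * (\<gamma> - 1) * P powr (\<gamma> - 2) * (4 * norm X^2) + 2 * ?n * \<gamma> * P powr (\<gamma> - 1))
      + \<beta> * h powr (- \<beta> - 1))
      < norm (\<chi> i. (if i = k then h powr (- \<beta>) else 0) - 2 * a * \<tau> powr (- \<beta>) * \<gamma> * P powr (\<gamma> - 1) * X $ i) powr p"
      unfolding Let_def P_def[symmetric] \<gamma>_def[symmetric] G_def g_def c_def S_def
      by (simp add: algebra_simps)
  qed
  then show ?thesis using a b by (intro exI[of _ a] conjI exI[of _ b]) auto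
qed

section \<open>Coordinate derivatives and continuity of a fixed solution\<close>

locale ancient =
  fixes k :: "'n::finite" and p :: real and u :: "real^'n \<Rightarrow> real \<Rightarrow> real"
  assumes p2: "p \<ge> 2" and sol: "ancient_solution k p u"
begin

lemma C21: "C21_on (halfQ k) u"
  using sol by (simp add: ancient_solution_def)

text \<open>\<open>pdx\<close> is a derivative at 0 along a shifted line; recentring gives the
  derivative along the whole line, as second-order tests require.\<close>

lemma pdx_has_derivative:
  assumes "(x + s *\<^sub>R axis i 1) $ k > 0" "t < 0"
  shows "((\<lambda>s. u (x + s *\<^sub>R axis i 1) t) has_real_derivative pdx u i (x + s *\<^sub>R axis i 1) t) (at s)"
proof -
  let ?y = "x + s *\<^sub>R axis i 1"
  have "(?y, t) \<in> halfQ k" using assms by (simp add: halfQ_def)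
  then have "(\<lambda>r. u (?y + r *\<^sub>R axis i 1) t) differentiable (at 0)"
    using C21 unfolding C21_on_def by blast
  then have "((\<lambda>r. u (?y + r *\<^sub>R axis i 1) t) has_real_derivative pdx u i ?y t) (at 0)"
    unfolding pdx_def by (metis DERIV_deriv_iff_real_differentiable)
  then have "((\<lambda>r. u (x + (r + s) *\<^sub>R axis i 1) t) has_real_derivative pdx u i ?y t) (at 0)"
    by (simp add: algebra_simps)
  then show ?thesis
    using DERIV_at_within_shift[of "\<lambda>r. u (x + r *\<^sub>R axis i 1) t" "pdx u i ?y t" s 0 UNIV]
    by (simp add: add.commute)
qed

lemma pdx_has_derivative_0:
  assumes "x $ k > 0" "t < 0"
  shows "((\<lambda>s. u (x + s *\<^sub>R axis i 1) t) has_real_derivative pdx u i x t) (at 0)"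
  using pdx_has_derivative[of x 0 i t] assms by simp

lemma pdx_pdx_has_derivative:
  assumes "x $ k > 0" "t < 0"
  shows "((\<lambda>s. pdx u i (x + s *\<^sub>R axis i 1) t) has_real_derivative pdx (pdx u i) i x t) (at 0)"
proof -
  have "(x, t) \<in> halfQ k" using assms by (simp add: halfQ_def)
  then have "(\<lambda>s. pdx u i (x + s *\<^sub>R axis i 1) t) differentiable (at 0)"
    using C21 unfolding C21_on_def by blast
  then show ?thesis
    unfolding pdx_def[of "pdx u i"] by (metis DERIV_deriv_iff_real_differentiable)
qed

lemma pdt_has_derivative:
  assumes "x $ k > 0" "t < 0"
  shows "((\<lambda>s. u x s) has_real_derivative pdt u x t) (at t)"
proof -
  have "(x, t) \<in> halfQ k" using assms by (simp add: halfQ_def)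
  then have "(\<lambda>s. u x s) differentiable (at t)"
    using C21 unfolding C21_on_def by blast
  then show ?thesis
    unfolding pdt_def by (metis DERIV_deriv_iff_real_differentiable)
qed

lemma cont_u: "continuous_on {(x, t). x $ k \<ge> 0 \<and> t \<le> 0} (\<lambda>(x, t). u x t)"
  using sol unfolding ancient_solution_def closure_halfQ by simp

lemma cont_u_comp:
  assumes "continuous_on S f" "continuous_on S g" "\<And>z. z \<in> S \<Longrightarrow> f z $ k \<ge> 0 \<and> g z \<le> 0"
  shows "continuous_on S (\<lambda>z. u (f z) (g z))"
proof -
  have "continuous_on S ((\<lambda>(x, t). u x t) \<circ> (\<lambda>z. (f z, g z)))"
    by (intro continuous_on_compose continuous_intros assms continuous_on_subset[OF cont_u])
      (use assms in auto)
  then show ?thesis by (simp add: o_def)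
qed

lemma pde:
  assumes "x $ k > 0" "t < 0"
  shows "pdt u x t = slap u x t + norm (sgrad u x t) powr p"
  using sol assms unfolding ancient_solution_def halfQ_def by force

lemma bdry: "x $ k = 0 \<Longrightarrow> t < 0 \<Longrightarrow> u x t = 0"
  using sol unfolding ancient_solution_def by blast

section \<open>Nonnegativity\<close>

text \<open>The comparison function V satisfies V_t - \<Delta>V + a^2 V \<le> 0, and its three
  penalties have separate tasks. The quadratic one makes V negative on the lateral sphere; exp(-a^2
  (t - t0 + T)) solves z' = -a^2 z and starts from 1, which settles the initial time; the constant
  pays, through the term a^2 V, for the Laplacian 2 n / R^2 of the quadratic one.\<close>

lemma nonneg_aux:
  fixes x0 :: "real^'n"
  assumes x0: "x0 $ k > 0" and t0: "t0 < 0" and R: "R > 0" and T: "T > 0"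
    and M: "M > 0" and a: "a > 0"
    and young: "\<And>q. q \<ge> 0 \<Longrightarrow> M * q^2 \<le> q powr p + a^2 / M"
  shows "exp (- (a * x0 $ k)) - exp (- (a^2 * T)) - 2 * real CARD('n) / (R^2 * a^2) \<le> exp (M * u x0 t0)"
proof (rule ccontr)
  let ?n = "real CARD('n)"
  define V where "V = (\<lambda>(x::real^'n) t. exp (- (a * x $ k)) - (norm (x - x0)^2 / R^2
     + exp (- (a^2 * (t - t0 + T))) + 2 * ?n / (R^2 * a^2)))"
  define F where "F = (\<lambda>(x::real^'n) t. V x t - exp (M * u x t))"
  define S where "S = (cball x0 R \<inter> {x. x $ k \<ge> 0}) \<times> {t0 - T..t0}"
  assume "\<not> ?thesis"
  then have pos0: "F x0 t0 > 0" by (simp add: F_def V_def)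
  have "closed {x::real^'n. x $ k \<ge> 0}"
    by (intro closed_Collect_le continuous_intros)
  then have "compact S" unfolding S_def
    by (intro compact_Times compact_Icc compact_Int_closed compact_cball)
  moreover have "(x0, t0) \<in> S" using x0 R T by (simp add: S_def)
  moreover have "continuous_on S (\<lambda>z. F (fst z) (snd z))"
    unfolding F_def V_def
    by (intro continuous_intros cont_u_comp) (use t0 R in \<open>auto simp: S_def\<close>)
  ultimately obtain z where z: "z \<in> S" "\<And>w. w \<in> S \<Longrightarrow> F (fst w) (snd w) \<le> F (fst z) (snd z)"
    using continuous_attains_sup[of S "\<lambda>z. F (fst z) (snd z)"] by blast
  obtain x t where zx: "z = (x, t)" by force
  have mx: "F y s \<le> F x t" if "norm (y - x0) \<le> R" "y $ k \<ge> 0" "t0 - T \<le> s" "s \<le> t0" for y s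
    using z(2)[of "(y, s)"] that zx by (auto simp: S_def dist_norm norm_minus_commute)
  have xt: "norm (x - x0) \<le> R" "x $ k \<ge> 0" "t0 - T \<le> t" "t \<le> t0"
    using z(1) zx by (auto simp: S_def dist_norm norm_minus_commute)
  have Fpos: "F x t > 0" using mx[of x0 t0] pos0 x0 R T by auto
  have Vpos: "V x t > 0" using Fpos unfolding F_def by (smt (verit) exp_gt_zero)
  have ex1: "exp (- (a * x $ k)) \<le> 1" using a xt by simp
  have c0: "2 * ?n / (R^2 * a^2) > 0" using R a by (simp add: card_gt_0_iff)
  have xR: "norm (x - x0) < R"
  proof (rule ccontr)
    assume "\<not> ?thesis"
    then have "norm (x - x0)^2 / R^2 = 1" using xt R by simp
    then show False using Vpos ex1 c0 unfolding V_def
      by (smt (verit) exp_gt_zero)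
  qed
  have tT: "t0 - T < t"
  proof (rule ccontr)
    assume "\<not> ?thesis"
    then have "t = t0 - T" using xt by simp
    then have "exp (- (a^2 * (t - t0 + T))) = 1" by simp
    moreover have "norm (x - x0)^2 / R^2 \<ge> 0" by simp
    ultimately show False using Vpos ex1 c0 unfolding V_def by linarith
  qed
  have t: "t < 0" using xt t0 by simp
  have xk: "x $ k > 0"
  proof (rule ccontr)
    assume "\<not> ?thesis"
    then have x0: "x $ k = 0" using xt by simp
    then have "u x t = 0" using bdry t by auto
    then have "F x t = - (norm (x - x0)^2 / R^2) - exp (- (a^2 * (t - t0 + T))) - 2 * ?n / (R^2 * a^2)"
      unfolding F_def V_def using x0 by simp
    moreover have "norm (x - x0)^2 / R^2 \<ge> 0" by simp
    ultimately show False using Fpos c0 by (smt (verit) exp_gt_zero)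
  qed
  define w where "w = exp (M * u x t)"
  have wpos: "w > 0" by (simp add: w_def)
  define e where "e = min (x $ k) (R - norm (x - x0))"
  have e: "e > 0" using xk xR by (simp add: e_def)
  have near: "(x + s *\<^sub>R axis i 1) $ k > 0 \<and> norm (x + s *\<^sub>R axis i 1 - x0) \<le> R" if "\<bar>s\<bar> < e" for s i
  proof
    show "(x + s *\<^sub>R axis i 1) $ k > 0" unfolding shift_nth using that by (auto simp: e_def)
    show "norm (x + s *\<^sub>R axis i 1 - x0) \<le> R"
      using norm_shift_le[of x s i x0] that by (simp add: e_def)
  qed
  have sp: "(if i = k then a^2 * exp (- (a * x $ k)) else 0) - 2 / R^2
      - (M * w * pdx (pdx u i) i x t + M^2 * w * (pdx u i x t)^2) \<le> 0" for i
  proof -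
    \<comment> \<open>An indicator with c * c = c lets one computation cover the normal and the
      tangential directions.\<close>
    define c where "c = (if i = k then 1 else (0::real))"
    have cc: "c * c = c" by (simp add: c_def)
    define Q where "Q = 1 / R^2"
    let ?f = "\<lambda>s. F (x + s *\<^sub>R axis i 1) t"
    let ?f' = "\<lambda>s. - a * c * exp (- (a * (x $ k + c * s))) - (2 * (x - x0) $ i + 2 * s) * Q
       - exp (M * u (x + s *\<^sub>R axis i 1) t) * (M * pdx u i (x + s *\<^sub>R axis i 1) t)"
    let ?D = "a^2 * c * exp (- (a * x $ k)) - 2 * Q
      - (M * w * pdx (pdx u i) i x t + M^2 * w * (pdx u i x t)^2)"
    have feq: "?f = (\<lambda>s. exp (- (a * (x $ k + c * s))) - ((norm (x - x0)^2 + 2 * s * (x - x0) $ i + s^2) * Q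
     + exp (- (a^2 * (t - t0 + T))) + 2 * ?n / (R^2 * a^2)) - exp (M * u (x + s *\<^sub>R axis i 1) t))"
      unfolding F_def V_def norm_sq_shift by (auto simp only: c_def shift_nth Q_def) auto
    have 1: "(?f has_real_derivative ?f' s) (at s)" if "\<bar>s\<bar> < e" for s
    proof -
      have du: "((\<lambda>s. u (x + s *\<^sub>R axis i 1) t) has_real_derivative pdx u i (x + s *\<^sub>R axis i 1) t) (at s)"
        using near[OF that, of i] t by (intro pdx_has_derivative) auto
      show ?thesis unfolding feq
        by (rule derivative_eq_intros du refl | simp)+
    qed
    have 2: "(?f' has_real_derivative ?D) (at 0)"
      apply (rule derivative_eq_intros pdx_has_derivative_0[OF xk t] pdx_pdx_has_derivative[OF xk t] refl)+
      using cc by (simp add: w_def power2_eq_square algebra_simps)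
    have 3: "?f s \<le> ?f 0" if "\<bar>s\<bar> < e" for s
      using mx[of "x + s *\<^sub>R axis i 1" t] near[OF that, of i] xt by simp
    have "?D \<le> 0" by (rule second_derivative_test(2)[OF e 1 2 3])
    then show ?thesis by (auto simp: c_def Q_def)
  qed
  have tm: "a^2 * exp (- (a^2 * (t - t0 + T))) - M * w * pdt u x t \<ge> 0"
  proof (rule left_derivative_test[OF _ tT, where f = "\<lambda>s. F x s"])
    show "((\<lambda>s. F x s) has_real_derivative a^2 * exp (- (a^2 * (t - t0 + T))) - M * w * pdt u x t) (at t)"
      unfolding F_def V_def w_def using xk t R
      by (auto intro!: derivative_eq_intros pdt_has_derivative)
  qed (use mx xt in auto)
  have "(\<Sum>i\<in>UNIV. (if i = k then a^2 * exp (- (a * x $ k)) else 0) - 2 / R^2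
      - (M * w * pdx (pdx u i) i x t + M^2 * w * (pdx u i x t)^2)) \<le> 0"
    by (intro sum_nonpos sp)
  also have "(\<Sum>i\<in>UNIV. (if i = k then a^2 * exp (- (a * x $ k)) else 0) - 2 / R^2
      - (M * w * pdx (pdx u i) i x t + M^2 * w * (pdx u i x t)^2))
     = a^2 * exp (- (a * x $ k)) - ?n * (2 / R^2) - (M * w * slap u x t + M^2 * w * norm (sgrad u x t)^2)"
    by (simp add: sum_subtractf sum.distrib slap_def norm_sq_sum sgrad_def flip: sum_distrib_left)
  finally have sp': "a^2 * exp (- (a * x $ k)) - ?n * (2 / R^2)
      \<le> M * w * slap u x t + M^2 * w * norm (sgrad u x t)^2" by simp
  let ?q = "norm (sgrad u x t)"
  have "M * (M * ?q^2) \<le> M * (?q powr p + a^2 / M)"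
    using young[of ?q] M by (intro mult_left_mono) auto
  also have "\<dots> = M * ?q powr p + a^2" using M by (simp add: distrib_left)
  finally have "w * (M * (M * ?q^2)) \<le> w * (M * ?q powr p + a^2)"
    using wpos by (intro mult_left_mono) auto
  then have y: "M^2 * w * ?q^2 - M * w * ?q powr p \<le> a^2 * w"
    by (simp add: algebra_simps power2_eq_square)
  have "a^2 * exp (- (a * x $ k)) - ?n * (2 / R^2) - a^2 * exp (- (a^2 * (t - t0 + T)))
      \<le> a^2 * w"
    using sp' tm y pde[OF xk t] by (simp add: algebra_simps)
  moreover have "a^2 * V x t = a^2 * exp (- (a * x $ k)) - ?n * (2 / R^2) - a^2 * exp (- (a^2 * (t - t0 + T)))
     - a^2 * (norm (x - x0)^2 / R^2)"
    using a R unfolding V_def by (simp add: field_simps)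
  moreover have "a^2 * (norm (x - x0)^2 / R^2) \<ge> 0" by simp
  ultimately have "a^2 * V x t \<le> a^2 * w" by linarith
  then have "V x t \<le> w" using a by simp
  then show False using Fpos by (simp add: F_def w_def)
qed

lemma nonneg:
  fixes x0 :: "real^'n"
  assumes x0: "x0 $ k \<ge> 0" and t0: "t0 < 0"
  shows "u x0 t0 \<ge> 0"
proof (cases "x0 $ k = 0")
  case False
  then have x0: "x0 $ k > 0" using x0 by simp
  have key: "u x0 t0 \<ge> - (d * x0 $ k)" if d: "d > 0" for d
  proof -
    define M where "M = d powr (p - 2)"
    define a where "a = d * M"
    have M: "M > 0" and a: "a > 0" using d by (auto simp: M_def a_def)
    have aM: "a^2 / M = d powr p"
    proof -
      have "a^2 / M = d^2 * M" using M by (simp add: a_def power2_eq_square)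
      also have "\<dots> = d powr 2 * d powr (p - 2)" using d by (simp add: M_def powr_numeral)
      also have "\<dots> = d powr p" by (simp flip: powr_add)
      finally show ?thesis .
    qed
    have young: "M * q^2 \<le> q powr p + a^2 / M" if q: "q \<ge> 0" for q
    proof (cases "q \<le> d")
      case True
      then have "M * q^2 \<le> M * d^2" using q M by (intro mult_left_mono power_mono) auto
      also have "\<dots> = a^2 / M" using M by (simp add: a_def power2_eq_square)
      finally show ?thesis by (smt (verit) powr_ge_zero)
    next
      case False
      then have "M * q^2 \<le> q powr (p - 2) * q^2"
        unfolding M_def using d p2 by (intro mult_right_mono powr_mono2) auto
      also have "\<dots> = q powr (p - 2) * q powr 2" using False d by (simp add: powr_numeral)
      also have "\<dots> = q powr p" by (simp flip: powr_add)
      finally show ?thesis using aM by (smt (verit) powr_ge_zero)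
    qed
    let ?n = "real CARD('n)"
    \<comment> \<open>T is tied to R, so a single limit removes both penalties that survive at (x0,
      t0).\<close>
    have "((\<lambda>R. exp (- (a * x0 $ k)) - exp (- (a^2 * R)) - 2 * ?n / (R^2 * a^2)) \<longlongrightarrow> exp (- (a * x0 $ k)) - 0 - 0) at_top"
    proof (intro tendsto_intros)
      show "((\<lambda>R. exp (- (a^2 * R))) \<longlongrightarrow> 0) at_top"
        using a by real_asymp
      show "((\<lambda>R. 2 * ?n / (R^2 * a^2)) \<longlongrightarrow> 0) at_top"
        using a by real_asymp
    qed
    moreover have "eventually (\<lambda>R. exp (- (a * x0 $ k)) - exp (- (a^2 * R)) - 2 * ?n / (R^2 * a^2) \<le> exp (M * u x0 t0)) at_top"
      using eventually_gt_at_top[of 0]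
      by eventually_elim (use nonneg_aux[OF x0 t0 _ _ M a young] in blast)
    ultimately have "exp (- (a * x0 $ k)) - 0 - 0 \<le> exp (M * u x0 t0)"
      by (rule tendsto_upperbound) simp
    then have "M * (- (d * x0 $ k)) \<le> M * u x0 t0" by (simp add: a_def algebra_simps)
    then show ?thesis using M mult_le_cancel_left_pos by blast
  qed
  have "((\<lambda>d. - (d * x0 $ k)) \<longlongrightarrow> - (0 * x0 $ k)) (at_right 0)"
    by (intro tendsto_intros)
  moreover have "eventually (\<lambda>d. - (d * x0 $ k) \<le> u x0 t0) (at_right 0)"
    using eventually_at_right_less[of 0] by eventually_elim (use key in auto)
  ultimately show ?thesis
    using tendsto_upperbound[of "\<lambda>d. - (d * x0 $ k)" _ "at_right 0" "u x0 t0"] by simp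
qed (use bdry t0 in simp)

section \<open>Upper bound\<close>

text \<open>Propagation of a large value: \<phi> = N - \<psi> + \<eta>(x_n - \<epsilon>) - \<eta>(d)
  stays below \<open>u\<close> up to time s + \<sigma>, and the conclusion reads this off at the
  foot of y on the face x_n = \<epsilon>. Height \<epsilon> keeps the face inside the domain, where
  \<open>u\<close> is differentiable; \<sigma> \<le> d^2 is the range of
  \<open>barrier_ok\<close>.\<close>

lemma lower_barrier:
  fixes y :: "real^'n"
  assumes \<beta>: "0 < \<beta>" "\<beta> < 1" and a: "a > 0" and b: "b > 0" and ok: "barrier_ok k p \<beta> a b"
    and \<epsilon>: "\<epsilon> > 0" and d: "d = y $ k - \<epsilon>" "d > 0" and s: "s < 0"
    and \<sigma>: "\<sigma> > 0" "s + \<sigma> < 0" "\<sigma> \<le> d^2" and N: "N < u y s"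
  shows "N - a * \<sigma> powr (- \<beta>) * (d^2 + b * \<sigma>) powr ((1 + \<beta>) / 2) - d powr (1 - \<beta>) / (1 - \<beta>)
    \<le> u (y + (- d) *\<^sub>R axis k 1) (s + \<sigma>)"
proof (rule ccontr)
  let ?n = "real CARD('n)"
  define \<gamma> where "\<gamma> = (1 + \<beta>) / 2"
  have \<gamma>: "\<gamma> > 0" "\<gamma> < 1" using \<beta> by (auto simp: \<gamma>_def)
  define \<eta> where "\<eta> = (\<lambda>h::real. h powr (1 - \<beta>) / (1 - \<beta>))"
  define \<psi> where "\<psi> = (\<lambda>(x::real^'n) t. a * (t - s) powr (- \<beta>) * (norm (x - y)^2 + b * (t - s)) powr \<gamma>)"
  define F where "F = (\<lambda>(x::real^'n) t. N - \<psi> x t + \<eta> (x $ k - \<epsilon>) - \<eta> d - u x t)"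
  define x1 where "x1 = y + (- d) *\<^sub>R axis k (1::real)"
  have x1k: "x1 $ k = \<epsilon>" unfolding x1_def shift_nth by (simp add: d)
  have x1y: "norm (x1 - y) = d" using d by (simp add: x1_def)
  assume "\<not> ?thesis"
  then have pos1: "F x1 (s + \<sigma>) > 0"
    unfolding F_def \<psi>_def x1y x1k by (simp add: \<eta>_def \<gamma>_def x1_def)
  have \<eta>mono: "\<eta> h \<le> \<eta> h'" if "0 \<le> h" "h \<le> h'" for h h'
    using that \<beta> unfolding \<eta>_def by (intro divide_right_mono powr_mono2) auto
  have \<eta>0: "\<eta> h \<ge> 0" for h using \<beta> by (simp add: \<eta>_def)
  have \<psi>lb: "\<psi> x t \<ge> a * (t - s) powr (- \<beta>) * norm (x - y) powr (1 + \<beta>)" if "t > s" for x t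
  proof -
    have "2 * \<gamma> = 1 + \<beta>" by (simp add: \<gamma>_def)
    then have "norm (x - y) powr (1 + \<beta>) = (norm (x - y)^2) powr \<gamma>"
      by (cases "x = y") (auto simp: powr_powr simp flip: powr_numeral)
    also have "\<dots> \<le> (norm (x - y)^2 + b * (t - s)) powr \<gamma>"
      using b that \<gamma> by (intro powr_mono2) auto
    finally show ?thesis unfolding \<psi>_def using a that by (intro mult_left_mono) auto
  qed
  \<comment> \<open>Since 1 + \<beta> > 1 - \<beta>, \<psi> outgrows \<eta>. Testing at \<sigma> is
    enough, because \<tau>^(-\<beta>) is larger at earlier times. On the sphere of radius R the
    barrier is then negative and \<open>nonneg\<close> suffices.\<close>
  have "eventually (\<lambda>R. N + (d + R) powr (1 - \<beta>) / (1 - \<beta>) < a * \<sigma> powr (- \<beta>) * R powr (1 + \<beta>)) at_top"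
    using a \<sigma> \<beta> d by real_asymp
  then obtain R where R: "R > d" and Rb: "N + \<eta> (d + R) < a * \<sigma> powr (- \<beta>) * R powr (1 + \<beta>)"
    unfolding \<eta>_def using eventually_conj[OF _ eventually_gt_at_top[of d]]
    by (metis (mono_tags, lifting) eventually_happens' trivial_limit_at_top_linorder)
  have xk_le: "x $ k - \<epsilon> \<le> d + norm (x - y)" for x
    using component_le_norm_cart[of "x - y" k] d by simp
  text \<open>As the time \<open>s + \<sigma>0\<close> decreases to \<open>s\<close>, the barrier concentrates at \<open>y\<close>, where it stays below \<open>u\<close>.\<close>
  obtain \<sigma>0 where \<sigma>0: "0 < \<sigma>0" "\<sigma>0 < \<sigma>"
    and init: "\<And>x. norm (x - y) \<le> R \<Longrightarrow> x $ k \<ge> \<epsilon> \<Longrightarrow> F x (s + \<sigma>0) \<le> 0"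
  proof -
    define e where "e = (u y s - N) / 2"
    have e: "e > 0" using N by (simp add: e_def)
    have "continuous_on ({x. x $ k \<ge> 0} \<times> {..0}) (\<lambda>z. u (fst z) (snd z))"
      by (intro cont_u_comp continuous_intros) auto
    moreover have "(y, s) \<in> {x. x $ k \<ge> 0} \<times> {..0}" using d \<epsilon> s by auto
    ultimately obtain r1 where r1: "r1 > 0"
      "\<And>z. z \<in> {x. x $ k \<ge> 0} \<times> {..0} \<Longrightarrow> dist z (y, s) < r1 \<Longrightarrow> dist (u (fst z) (snd z)) (u y s) < e"
      unfolding continuous_on_iff using e by (metis fst_conv snd_conv)
    have "isCont \<eta> d" unfolding \<eta>_def using \<beta> d by (intro continuous_intros) auto
    then obtain r2 where r2: "r2 > 0" "\<And>h. dist h d < r2 \<Longrightarrow> dist (\<eta> h) (\<eta> d) < e"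
      unfolding continuous_at_eps_delta using e by (auto simp: dist_norm)
    define r where "r = min (r1 / 2) r2"
    have r: "r > 0" using r1 r2 by (simp add: r_def)
    have "filterlim (\<lambda>\<sigma>. a * r powr (1 + \<beta>) * \<sigma> powr (- \<beta>)) at_top (at_right 0)"
      using a r \<beta> by real_asymp
    then have "eventually (\<lambda>\<sigma>. N + \<eta> (d + R) \<le> a * r powr (1 + \<beta>) * \<sigma> powr (- \<beta>)) (at_right 0)"
      by (simp add: filterlim_at_top)
    moreover have "eventually (\<lambda>q. q < min \<sigma> (r1 / 2)) (at_right (0::real))"
      using \<sigma> r1 by (intro order_tendstoD) auto
    moreover have "eventually (\<lambda>q. q > 0) (at_right (0::real))" by (simp add: eventually_at_right_less)
    ultimately have "eventually (\<lambda>\<sigma>'. N + \<eta> (d + R) \<le> a * r powr (1 + \<beta>) * \<sigma>' powr (- \<beta>) \<and> \<sigma>' < min \<sigma> (r1 / 2) \<and> \<sigma>' > 0) (at_right 0)"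
      by eventually_elim auto
    then obtain q where q: "N + \<eta> (d + R) \<le> a * r powr (1 + \<beta>) * q powr (- \<beta>)" "q < \<sigma>" "q < r1 / 2" "q > 0"
      using eventually_happens'[OF trivial_limit_at_right_real] by fastforce
    show thesis
    proof (rule that[of q])
      fix x :: "real^'n" assume x: "norm (x - y) \<le> R" "x $ k \<ge> \<epsilon>"
      have sq: "s + q \<le> 0" using q \<sigma> by simp
      show "F x (s + q) \<le> 0"
      proof (cases "norm (x - y) < r")
        case True
        have "dist (x, s + q) (y, s) \<le> norm (x - y) + q"
          using sqrt_sum_squares_le_sum[of "dist x y" "dist (s + q) s"] q
          unfolding dist_Pair_Pair by (simp add: dist_norm)
        then have "dist (u x (s + q)) (u y s) < e"
          using r1(2)[of "(x, s + q)"] x \<epsilon> sq True q by (auto simp: r_def)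
        moreover have "dist (\<eta> (x $ k - \<epsilon>)) (\<eta> d) < e"
        proof (rule r2(2))
          have "\<bar>(x - y) $ k\<bar> \<le> norm (x - y)" by (rule component_le_norm_cart)
          then show "dist (x $ k - \<epsilon>) d < r2" using True by (simp add: dist_real_def d r_def)
        qed
        moreover have "\<psi> x (s + q) \<ge> 0" using a q by (simp add: \<psi>_def)
        ultimately show ?thesis unfolding F_def e_def dist_real_def abs_less_iff
          by (simp add: field_simps)
      next
        case False
        have "\<eta> (x $ k - \<epsilon>) \<le> \<eta> (d + R)" using x xk_le[of x] by (intro \<eta>mono) auto
        moreover have "a * r powr (1 + \<beta>) * q powr (- \<beta>) \<le> \<psi> x (s + q)"
        proof -
          have "r powr (1 + \<beta>) \<le> norm (x - y) powr (1 + \<beta>)"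
            using False r \<beta> by (intro powr_mono2) auto
          then have "(a * q powr (- \<beta>)) * r powr (1 + \<beta>) \<le> (a * q powr (- \<beta>)) * norm (x - y) powr (1 + \<beta>)"
            using a by (intro mult_left_mono) auto
          then show ?thesis using \<psi>lb[of "s + q" x] q by (simp add: mult_ac)
        qed
        moreover have "u x (s + q) \<ge> 0" using nonneg[of x "s + q"] x \<epsilon> q \<sigma> by simp
        ultimately show ?thesis using q(1) \<eta>0[of d] unfolding F_def by linarith
      qed
    qed (use q in auto)
  qed
  define S where "S = (cball y R \<inter> {x. x $ k \<ge> \<epsilon>}) \<times> {s + \<sigma>0..s + \<sigma>}"
  have "closed {x::real^'n. x $ k \<ge> \<epsilon>}"
    by (intro closed_Collect_le continuous_intros)
  then have "compact S" unfolding S_def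
    by (intro compact_Times compact_Icc compact_Int_closed compact_cball)
  moreover have x1S: "(x1, s + \<sigma>) \<in> S"
    using x1k x1y R \<sigma>0 by (simp add: S_def dist_norm norm_minus_commute)
  moreover have "continuous_on S (\<lambda>z. F (fst z) (snd z))"
  proof -
    have "continuous_on S (\<lambda>z. (snd z - s) powr (- \<beta>))"
      using \<sigma>0 by (intro continuous_intros) (auto simp: S_def)
    moreover have "continuous_on S (\<lambda>z. ((norm (fst z - y))\<^sup>2 + b * (snd z - s)) powr \<gamma>)"
      using b \<sigma>0 \<gamma> by (intro continuous_on_powr' continuous_intros) (auto simp: S_def)
    moreover have "continuous_on S (\<lambda>z. (fst z $ k - \<epsilon>) powr (1 - \<beta>))"
      using \<beta> by (intro continuous_on_powr' continuous_intros) (auto simp: S_def)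
    moreover have "continuous_on S (\<lambda>z. u (fst z) (snd z))"
      using \<sigma> \<epsilon> by (intro cont_u_comp continuous_intros) (auto simp: S_def)
    ultimately show ?thesis
      unfolding F_def \<psi>_def \<eta>_def
      by (intro continuous_on_add continuous_on_diff continuous_on_mult continuous_on_const
          continuous_on_divide) (use \<beta> in auto)
  qed
  ultimately obtain z where z: "z \<in> S" "\<And>w. w \<in> S \<Longrightarrow> F (fst w) (snd w) \<le> F (fst z) (snd z)"
    using continuous_attains_sup[of S "\<lambda>z. F (fst z) (snd z)"] by blast
  obtain x t where zx: "z = (x, t)" by force
  have mx: "F y' s' \<le> F x t" if "norm (y' - y) \<le> R" "y' $ k \<ge> \<epsilon>" "s + \<sigma>0 \<le> s'" "s' \<le> s + \<sigma>" for y' s'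
    using z(2)[of "(y', s')"] that zx by (auto simp: S_def dist_norm norm_minus_commute)
  have xt: "norm (x - y) \<le> R" "x $ k \<ge> \<epsilon>" "s + \<sigma>0 \<le> t" "t \<le> s + \<sigma>"
    using z(1) zx by (auto simp: S_def dist_norm norm_minus_commute)
  have Fpos: "F x t > 0" using mx[of x1 "s + \<sigma>"] pos1 x1k x1y R \<sigma>0 by auto
  have t: "t < 0" "s < t" using xt \<sigma> \<sigma>0 by auto
  have xk0: "x $ k > 0" using xt \<epsilon> by simp
  have xR: "norm (x - y) < R"
  proof (rule ccontr)
    assume "\<not> ?thesis"
    then have nR: "norm (x - y) = R" using xt by simp
    have "\<sigma> powr (- \<beta>) \<le> (t - s) powr (- \<beta>)"
      using xt t \<beta> by (intro powr_mono2') auto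
    then have "a * \<sigma> powr (- \<beta>) * R powr (1 + \<beta>) \<le> a * (t - s) powr (- \<beta>) * R powr (1 + \<beta>)"
      using a by (intro mult_right_mono mult_left_mono) auto
    also have "\<dots> \<le> \<psi> x t" using \<psi>lb[OF t(2), of x] nR by simp
    finally have "N + \<eta> (d + R) < \<psi> x t" using Rb by linarith
    moreover have "\<eta> (x $ k - \<epsilon>) \<le> \<eta> (d + R)" using xt xk_le[of x] by (intro \<eta>mono) auto
    moreover have "u x t \<ge> 0" using nonneg[of x t] xk0 t by simp
    ultimately show False using Fpos \<eta>0[of d] unfolding F_def by linarith
  qed
  have tT: "s + \<sigma>0 < t"
    using init[of x] xt Fpos by (cases "t = s + \<sigma>0") auto
  define \<tau> where "\<tau> = t - s"
  define Q where "Q = norm (x - y)^2 + b * \<tau>"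
  define A where "A = a * \<tau> powr (- \<beta>)"
  have \<tau>: "\<tau> > 0" "\<tau> \<le> d^2" using t xt \<sigma> by (auto simp: \<tau>_def)
  have bt: "b * \<tau> > 0" using b \<tau> by simp
  have Qs: "Q + 2 * r * (x - y) $ i + r^2 > 0" for r i
  proof -
    have "Q + 2 * r * (x - y) $ i + r^2 = norm (x + r *\<^sub>R axis i 1 - y)^2 + b * \<tau>"
      unfolding norm_sq_shift Q_def by simp
    then show ?thesis using bt by (simp add: add_nonneg_pos)
  qed
  have Q: "Q > 0" using Qs[of 0] by simp
  have dQ: "((\<lambda>r. (Q + 2 * r * (x - y) $ i + r^2) powr q) has_real_derivative
     q * (Q + 2 * r * (x - y) $ i + r^2) powr (q - 1) * (2 * (x - y) $ i + 2 * r)) (at r)" for r q i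
    using DERIV_fun_powr[of "\<lambda>r. Q + 2 * r * (x - y) $ i + r^2" "2 * (x - y) $ i + 2 * r" r q] Qs[of r i]
    by (auto intro!: derivative_eq_intros)
  have Feq: "F (x + r *\<^sub>R axis i 1) t = N - A * (Q + 2 * r * (x - y) $ i + r^2) powr \<gamma>
      + \<eta> (x $ k - \<epsilon> + (if i = k then 1 else 0) * r) - \<eta> d - u (x + r *\<^sub>R axis i 1) t" for r i
    unfolding F_def \<psi>_def norm_sq_shift shift_nth A_def Q_def \<tau>_def by (simp add: algebra_simps)
  have near0: "norm (x + r *\<^sub>R axis i 1 - y) \<le> R" if "\<bar>r\<bar> < R - norm (x - y)" for r i
    using norm_shift_le[of x r i y] that by simp
  text \<open>A maximum on the face \<open>x $ k = \<epsilon>\<close> is impossible: there \<open>u\<close> and \<open>\<psi>\<close> are differentiable,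
    whereas \<open>\<eta>\<close> has infinite slope.\<close>
  have xk: "x $ k > \<epsilon>"
  proof (rule ccontr)
    assume "\<not> ?thesis"
    then have x\<epsilon>: "x $ k = \<epsilon>" using xt by simp
    define G where "G = (\<lambda>r. A * (Q + 2 * r * (x - y) $ k + r^2) powr \<gamma> + u (x + r *\<^sub>R axis k 1) t)"
    obtain D where "(G has_real_derivative D) (at 0)"
    proof -
      have "(G has_real_derivative A * (\<gamma> * (Q + 2 * 0 * (x - y) $ k + 0^2) powr (\<gamma> - 1) * (2 * (x - y) $ k + 2 * 0))
          + pdx u k x t) (at 0)"
        unfolding G_def by (intro DERIV_add DERIV_cmult dQ pdx_has_derivative_0 xk0 t)
      then show thesis by (rule that)
    qed
    then have lim: "((\<lambda>r. (G r - G 0) / r) \<longlongrightarrow> D) (at_right 0)"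
      by (simp add: has_field_derivative_iff filterlim_at_split)
    have le: "eventually (\<lambda>r. r powr (- \<beta>) / (1 - \<beta>) \<le> (G r - G 0) / r) (at_right 0)"
    proof -
      have "eventually (\<lambda>q. q < R - norm (x - y)) (at_right (0::real))"
        using xR by (intro order_tendstoD) auto
      moreover have "eventually (\<lambda>q. q > 0) (at_right (0::real))" by (simp add: eventually_at_right_less)
      ultimately show ?thesis
      proof eventually_elim
        case (elim r)
        have "F (x + r *\<^sub>R axis k 1) t \<le> F (x + 0 *\<^sub>R axis k 1) t"
          using mx[of "x + r *\<^sub>R axis k 1" t] near0[of r k] elim xt by (simp add: shift_nth del: vector_add_component)
        then have "\<eta> r \<le> G r - G 0"
          unfolding Feq x\<epsilon> G_def using \<beta> by (simp add: \<eta>_def)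
        then have "\<eta> r / r \<le> (G r - G 0) / r" using elim by (intro divide_right_mono) auto
        moreover have "r powr (1 - \<beta>) = r * r powr (- \<beta>)"
          using elim powr_add[of r 1 "- \<beta>"] by simp
        then have "\<eta> r / r = r powr (- \<beta>) / (1 - \<beta>)" using elim by (simp add: \<eta>_def)
        ultimately show ?case by simp
      qed
    qed
    have "filterlim (\<lambda>r. r powr (- \<beta>) / (1 - \<beta>)) at_top (at_right 0)"
      using \<beta> by real_asymp
    then have "filterlim (\<lambda>r. (G r - G 0) / r) at_top (at_right 0)"
      by (rule filterlim_at_top_mono[OF _ le])
    then have "filterlim (\<lambda>r. (G r - G 0) / r) at_infinity (at_right 0)"
      by (rule filterlim_at_top_imp_at_infinity)
    with lim show False
      using not_tendsto_and_filterlim_at_infinity[OF trivial_limit_at_right_real] by blast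
  qed
  define h where "h = x $ k - \<epsilon>"
  have h: "h > 0" using xk by (simp add: h_def)
  define e where "e = min h (R - norm (x - y))"
  have e: "e > 0" using h xR by (simp add: e_def)
  define g where "g = (\<lambda>i. (if i = k then h powr (- \<beta>) else 0) - 2 * A * \<gamma> * Q powr (\<gamma> - 1) * (x - y) $ i)"
  have sp: "pdx u i x t = g i \<and>
      - (A * (\<gamma> * (\<gamma> - 1) * Q powr (\<gamma> - 2) * (4 * ((x - y) $ i)^2) + 2 * \<gamma> * Q powr (\<gamma> - 1)))
      - (if i = k then \<beta> * h powr (- \<beta> - 1) else 0) - pdx (pdx u i) i x t \<le> 0" for i
  proof -
    define c where "c = (if i = k then 1 else (0::real))"
    have cc: "c * c = c" by (simp add: c_def)
    have hc: "h + c * r > 0" if "\<bar>r\<bar> < e" for r using that h by (auto simp: c_def e_def)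
    define X where "X = (x - y) $ i"
    let ?f = "\<lambda>r. F (x + r *\<^sub>R axis i 1) t"
    let ?f' = "\<lambda>r. - (A * (\<gamma> * (Q + 2 * r * X + r^2) powr (\<gamma> - 1) * (2 * X + 2 * r)))
      + c * (h + c * r) powr (- \<beta>) - pdx u i (x + r *\<^sub>R axis i 1) t"
    let ?D = "- (A * (\<gamma> * (\<gamma> - 1) * Q powr (\<gamma> - 2) * (4 * X^2) + 2 * \<gamma> * Q powr (\<gamma> - 1)))
      - c * \<beta> * h powr (- \<beta> - 1) - pdx (pdx u i) i x t"
    have dh: "((\<lambda>r. (h + c * r) powr q) has_real_derivative q * (h + c * r) powr (q - 1) * c) (at r)"
      if "\<bar>r\<bar> < e" for r q
      using DERIV_fun_powr[of "\<lambda>r. h + c * r" c r q] hc[OF that]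
      by (auto intro!: derivative_eq_intros)
    have feq: "?f = (\<lambda>r. N - A * (Q + 2 * r * X + r^2) powr \<gamma>
      + (h + c * r) powr (1 - \<beta>) / (1 - \<beta>) - \<eta> d - u (x + r *\<^sub>R axis i 1) t)"
      unfolding Feq c_def h_def X_def \<eta>_def ..
    have 1: "(?f has_real_derivative ?f' r) (at r)" if r: "\<bar>r\<bar> < e" for r
    proof -
      have du: "((\<lambda>s. u (x + s *\<^sub>R axis i 1) t) has_real_derivative pdx u i (x + r *\<^sub>R axis i 1) t) (at r)"
        using r h \<epsilon> t unfolding h_def
        by (intro pdx_has_derivative) (auto simp: shift_nth e_def h_def simp del: vector_add_component)
      show ?thesis unfolding feq
        by (rule DERIV_cong, (rule DERIV_add DERIV_diff DERIV_const DERIV_cmult DERIV_cdivide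
              dQ[where i = i, folded X_def] dh[OF r] du)+)
          (use \<beta> in simp)
    qed
    have 2: "(?f' has_real_derivative ?D) (at 0)"
    proof -
      have l: "((\<lambda>r. 2 * X + 2 * r) has_real_derivative 2) (at 0)"
        by (auto intro!: derivative_eq_intros)
      have h0: "((\<lambda>r. (h + c * r) powr (- \<beta>)) has_real_derivative (- \<beta>) * (h + c * 0) powr (- \<beta> - 1) * c) (at 0)"
        using e by (intro dh) simp
      show ?thesis
        by (rule DERIV_cong, (rule l h0 DERIV_add DERIV_diff DERIV_minus DERIV_cmult
              dQ[where i = i, folded X_def] pdx_pdx_has_derivative[OF xk0 t(1)] DERIV_mult)+)
          (use cc in \<open>auto simp: power2_eq_square algebra_simps\<close>)
    qed
    have 3: "?f r \<le> ?f 0" if "\<bar>r\<bar> < e" for r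
    proof -
      have "(x + r *\<^sub>R axis i 1) $ k \<ge> \<epsilon>"
        unfolding shift_nth using that by (auto simp: e_def h_def)
      then show ?thesis
        using mx[of "x + r *\<^sub>R axis i 1" t] near0[of r i] that xt by (simp add: e_def)
    qed
    have "?f' 0 = 0" "?D \<le> 0" by (rule second_derivative_test[OF e 1 2 3]; assumption)+
    moreover have "A * (\<gamma> * Q powr (\<gamma> - 1) * (2 * X)) = 2 * A * \<gamma> * Q powr (\<gamma> - 1) * X"
      by simp
    ultimately show ?thesis unfolding g_def X_def[symmetric] by (auto simp: c_def)
  qed
  have tm: "a * \<beta> * \<tau> powr (- \<beta> - 1) * Q powr \<gamma> - A * \<gamma> * Q powr (\<gamma> - 1) * b - pdt u x t \<ge> 0"
  proof (rule left_derivative_test[OF _ tT, where f = "\<lambda>r. F x r"])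
    have 1: "((\<lambda>r. (r - s) powr (- \<beta>)) has_real_derivative (- \<beta>) * \<tau> powr (- \<beta> - 1) * 1) (at t)"
      using DERIV_fun_powr[of "\<lambda>r. r - s" 1 t "- \<beta>"] \<tau> by (auto intro!: derivative_eq_intros simp: \<tau>_def)
    have 2: "((\<lambda>r. (norm (x - y)^2 + b * (r - s)) powr \<gamma>) has_real_derivative \<gamma> * Q powr (\<gamma> - 1) * b) (at t)"
      using DERIV_fun_powr[of "\<lambda>r. norm (x - y)^2 + b * (r - s)" b t \<gamma>] Q
      by (auto intro!: derivative_eq_intros simp: \<tau>_def Q_def)
    have Qt: "norm (x - y)^2 + b * (t - s) = Q" by (simp add: Q_def \<tau>_def)
    show "((\<lambda>r. F x r) has_real_derivative a * \<beta> * \<tau> powr (- \<beta> - 1) * Q powr \<gamma> - A * \<gamma> * Q powr (\<gamma> - 1) * b - pdt u x t) (at t)"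
      unfolding F_def \<psi>_def
      by (rule DERIV_cong, (rule 1 2 DERIV_add DERIV_diff DERIV_const DERIV_mult pdt_has_derivative[OF xk0 t(1)])+)
        (simp only: Qt, simp add: A_def \<tau>_def algebra_simps)
  qed (use mx xt in auto)
  have "(\<Sum>i\<in>UNIV. - (A * (\<gamma> * (\<gamma> - 1) * Q powr (\<gamma> - 2) * (4 * ((x - y) $ i)^2) + 2 * \<gamma> * Q powr (\<gamma> - 1)))
      - (if i = k then \<beta> * h powr (- \<beta> - 1) else 0) - pdx (pdx u i) i x t) \<le> 0"
    using sp by (intro sum_nonpos) blast
  also have "(\<Sum>i\<in>UNIV. - (A * (\<gamma> * (\<gamma> - 1) * Q powr (\<gamma> - 2) * (4 * ((x - y) $ i)^2) + 2 * \<gamma> * Q powr (\<gamma> - 1)))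
      - (if i = k then \<beta> * h powr (- \<beta> - 1) else 0) - pdx (pdx u i) i x t)
     = - (A * (\<gamma> * (\<gamma> - 1) * Q powr (\<gamma> - 2) * (4 * norm (x - y)^2) + 2 * ?n * \<gamma> * Q powr (\<gamma> - 1)))
      - \<beta> * h powr (- \<beta> - 1) - slap u x t"
    unfolding norm_sq_sum by (simp add: sum_subtractf sum.distrib slap_def sum_negf algebra_simps flip: sum_distrib_left)
  finally have sl: "- slap u x t \<le> A * (\<gamma> * (\<gamma> - 1) * Q powr (\<gamma> - 2) * (4 * norm (x - y)^2) + 2 * ?n * \<gamma> * Q powr (\<gamma> - 1))
      + \<beta> * h powr (- \<beta> - 1)" by linarith
  \<comment> \<open>At the maximum the gradients of \<phi> and \<open>u\<close> agree, so the same
    p-th power occurs in both relations, and the strict inequality of \<open>barrier_ok\<close>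
    contradicts the equation.\<close>
  have "sgrad u x t = (\<chi> i. g i)" using sp by (simp add: sgrad_def)
  then have gr: "norm (sgrad u x t) = norm (\<chi> i. (if i = k then h powr (- \<beta>) else 0) - 2 * a * \<tau> powr (- \<beta>) * \<gamma> * Q powr (\<gamma> - 1) * (x - y) $ i)"
    by (simp add: g_def A_def mult_ac)
  have "(x - y) $ k = h - d" using d by (simp add: h_def)
  then have "a * \<beta> * \<tau> powr (- \<beta> - 1) * Q powr \<gamma> - a * \<tau> powr (- \<beta>) * \<gamma> * Q powr (\<gamma> - 1) * b
      + (a * \<tau> powr (- \<beta>) * (\<gamma> * (\<gamma> - 1) * Q powr (\<gamma> - 2) * (4 * norm (x - y)^2) + 2 * ?n * \<gamma> * Q powr (\<gamma> - 1))
      + \<beta> * h powr (- \<beta> - 1)) < norm (sgrad u x t) powr p"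
    unfolding gr using ok d(2) \<tau> h unfolding barrier_ok_def Let_def Q_def \<gamma>_def by blast
  then show False using tm sl pde[OF xk0 t(1)] unfolding A_def by linarith
qed

text \<open>As \<epsilon> -> 0 the foot point reaches the boundary, where \<open>u\<close> vanishes;
  \<open>dense_le\<close> then lets N increase to \<open>u y s\<close>.\<close>

lemma upper_sharp:
  fixes y :: "real^'n"
  assumes \<beta>: "0 < \<beta>" "\<beta> < 1" and a: "a > 0" and b: "b > 0" and ok: "barrier_ok k p \<beta> a b"
    and y: "y $ k > 0" and s: "s < 0" and \<sigma>: "\<sigma> > 0" "s + \<sigma> < 0" "\<sigma> < (y $ k)^2"
  shows "u y s \<le> a * \<sigma> powr (- \<beta>) * ((y $ k)^2 + b * \<sigma>) powr ((1 + \<beta>) / 2) + (y $ k) powr (1 - \<beta>) / (1 - \<beta>)"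
proof (rule dense_le)
  fix N assume N: "N < u y s"
  let ?l = "\<lambda>\<epsilon>. N - a * \<sigma> powr (- \<beta>) * ((y $ k - \<epsilon>)^2 + b * \<sigma>) powr ((1 + \<beta>) / 2) - (y $ k - \<epsilon>) powr (1 - \<beta>) / (1 - \<beta>)"
  let ?r = "\<lambda>\<epsilon>. u (y + (- (y $ k - \<epsilon>)) *\<^sub>R axis k 1) (s + \<sigma>)"
  have kk: "(y + (- (y $ k - \<epsilon>)) *\<^sub>R axis k 1) $ k = \<epsilon>" for \<epsilon>
    unfolding shift_nth by simp
  have "continuous_on {0..} ?r"
    by (intro cont_u_comp continuous_intros) (use kk \<sigma> in auto)
  then have "(?r \<longlongrightarrow> ?r 0) (at 0 within {0..})" unfolding continuous_on_def by (rule bspec) simp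
  then have r: "(?r \<longlongrightarrow> ?r 0) (at_right 0)" by (rule tendsto_within_subset) auto
  have r0: "?r 0 = 0" using kk[of 0] \<sigma> by (intro bdry) auto
  have l: "(?l \<longlongrightarrow> ?l 0) (at_right 0)"
    by (intro tendsto_intros) (use b \<sigma> y \<beta> in \<open>auto simp: add_pos_pos\<close>)
  have ev: "eventually (\<lambda>\<epsilon>. ?l \<epsilon> \<le> ?r \<epsilon>) (at_right 0)"
  proof -
    have "((\<lambda>\<epsilon>. (y $ k - \<epsilon>)^2) \<longlongrightarrow> (y $ k - 0)^2) (at_right 0)" by (intro tendsto_intros)
    then have "eventually (\<lambda>\<epsilon>. \<sigma> < (y $ k - \<epsilon>)^2) (at_right 0)"
      using \<sigma> by (intro order_tendstoD) auto
    moreover have "eventually (\<lambda>q. q < y $ k) (at_right (0::real))"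
      using y by (intro order_tendstoD) auto
    moreover have "eventually (\<lambda>q. q > 0) (at_right (0::real))" by (simp add: eventually_at_right_less)
    ultimately show ?thesis
    proof eventually_elim
      case (elim \<epsilon>)
      then show ?case
        using lower_barrier[OF \<beta> a b ok _ _ _ s \<sigma>(1,2) _ N, of \<epsilon> "y $ k - \<epsilon>"] by auto
    qed
  qed
  have "?l 0 \<le> ?r 0" by (rule tendsto_le[OF trivial_limit_at_right_real r l ev])
  then show "N \<le> a * \<sigma> powr (- \<beta>) * ((y $ k)^2 + b * \<sigma>) powr ((1 + \<beta>) / 2) + (y $ k) powr (1 - \<beta>) / (1 - \<beta>)"
    unfolding r0 by simp
qed

lemma upper_bound:
  fixes y :: "real^'n"
  assumes \<beta>: "0 < \<beta>" "\<beta> < 1" and a: "a > 0" and b: "b > 0" and ok: "barrier_ok k p \<beta> a b"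
    and y: "y $ k > 0" and s: "s < 0"
  shows "u y s \<le> (2 * a * (1 + b) powr ((1 + \<beta>) / 2) + 1 / (1 - \<beta>))
      * ((y $ k) powr (1 - \<beta>) + (y $ k) powr (1 + \<beta>) * \<bar>s\<bar> powr (- \<beta>))"
proof -
  define d where "d = y $ k"
  have d: "d > 0" using y by (simp add: d_def)
  \<comment> \<open>Half of the minimum meets both strict requirements. The alternative |s|/2
    produces the term with |s|^(-\<beta>), the alternative d^2/2 the stationary term
    d^(1-\<beta>).\<close>
  define \<sigma> where "\<sigma> = min \<bar>s\<bar> (d^2) / 2"
  have \<sigma>: "\<sigma> > 0" "s + \<sigma> < 0" "\<sigma> < d^2" using s d by (auto simp: \<sigma>_def min_def)
  define B where "B = (1 + b) powr ((1 + \<beta>) / 2)"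
  have 1: "(d^2 + b * \<sigma>) powr ((1 + \<beta>) / 2) \<le> B * d powr (1 + \<beta>)"
  proof -
    have "d^2 + b * \<sigma> \<le> (1 + b) * d^2" using \<sigma> b by (simp add: algebra_simps)
    then have "(d^2 + b * \<sigma>) powr ((1 + \<beta>) / 2) \<le> ((1 + b) * d^2) powr ((1 + \<beta>) / 2)"
      using \<sigma> b d \<beta> by (intro powr_mono2) auto
    also have "\<dots> = B * (d powr 2) powr ((1 + \<beta>) / 2)" using b d by (simp add: B_def powr_mult powr_numeral)
    also have "(d powr 2) powr ((1 + \<beta>) / 2) = d powr (2 * ((1 + \<beta>) / 2))" by (rule powr_powr)
    also have "2 * ((1 + \<beta>) / 2) = 1 + \<beta>" by simp
    finally show ?thesis .
  qed
  have 2: "\<sigma> powr (- \<beta>) \<le> 2 * (\<bar>s\<bar> powr (- \<beta>) + d powr (- 2 * \<beta>))"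
  proof -
    define m where "m = min \<bar>s\<bar> (d^2)"
    have m: "m > 0" "m = \<bar>s\<bar> \<or> m = d^2" using s d by (auto simp: m_def min_def)
    have "(d^2) powr (- \<beta>) = (d powr 2) powr (- \<beta>)" using d by (simp add: powr_numeral)
    also have "\<dots> = d powr (- 2 * \<beta>)" by (simp add: powr_powr)
    finally have "m powr (- \<beta>) \<le> \<bar>s\<bar> powr (- \<beta>) + d powr (- 2 * \<beta>)"
      using m(2) by (smt (verit) powr_ge_zero)
    moreover have "(2::real) powr \<beta> \<le> 2 powr 1" using \<beta> by (intro powr_mono) auto
    ultimately have "m powr (- \<beta>) * 2 powr \<beta> \<le> (\<bar>s\<bar> powr (- \<beta>) + d powr (- 2 * \<beta>)) * 2"
      by (intro mult_mono) auto
    moreover have "\<sigma> powr (- \<beta>) = m powr (- \<beta>) * 2 powr \<beta>"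
    proof -
      have "(m / 2) powr (- \<beta>) = m powr (- \<beta>) / 2 powr (- \<beta>)" by (rule powr_divide)
      also have "(2::real) powr (- \<beta>) = 1 / 2 powr \<beta>" by (rule powr_minus_divide)
      finally show ?thesis unfolding \<sigma>_def m_def[symmetric] by simp
    qed
    ultimately show ?thesis by (simp only: mult.commute)
  qed
  have dd: "d powr (- 2 * \<beta>) * d powr (1 + \<beta>) = d powr (1 - \<beta>)"
    by (subst powr_add[symmetric]) simp
  have "u y s \<le> a * \<sigma> powr (- \<beta>) * (d^2 + b * \<sigma>) powr ((1 + \<beta>) / 2) + d powr (1 - \<beta>) / (1 - \<beta>)"
    by (rule upper_sharp[OF \<beta> a b ok y s, folded d_def, OF \<sigma>])
  also have "\<dots> \<le> a * (2 * (\<bar>s\<bar> powr (- \<beta>) + d powr (- 2 * \<beta>))) * (B * d powr (1 + \<beta>)) + d powr (1 - \<beta>) / (1 - \<beta>)"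
    using 1 2 a by (intro add_right_mono mult_mono) auto
  also have "\<dots> = 2 * a * B * (d powr (1 + \<beta>) * \<bar>s\<bar> powr (- \<beta>) + d powr (- 2 * \<beta>) * d powr (1 + \<beta>)) + 1 / (1 - \<beta>) * d powr (1 - \<beta>)"
    by (simp add: algebra_simps)
  also have "\<dots> \<le> (2 * a * B + 1 / (1 - \<beta>)) * (d powr (1 - \<beta>) + d powr (1 + \<beta>) * \<bar>s\<bar> powr (- \<beta>))"
    unfolding dd using \<beta> by (simp add: algebra_simps)
  finally show ?thesis unfolding B_def d_def .
qed

section \<open>Gradient bound\<close>

text \<open>Instead of differentiating the equation, which would need more than \<open>C\<^sup>2\<^sup>,\<^sup>1\<close> regularity, the proof doubles
  variables: moving both points in the same direction leaves \<open>norm (x - y)\<close> unchanged, so only the pure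
  second derivatives enter. The transformation \<open>- ln (2 * M - u)\<close> makes the nonlinearity decreasing in the
  unknown.\<close>
lemma pdx_bound:
  fixes x0 :: "real^'n"
  assumes d: "x0 $ k > 0" and t0: "t0 < 0" and R: "R = x0 $ k / 2" and M: "M > 0"
    and MR: "R powr (p - 2) \<le> M powr (p - 1)"
    and uM: "\<And>y t. norm (y - x0) \<le> 3 * R / 2 \<Longrightarrow> t \<le> t0 \<Longrightarrow> u y t \<le> M"
  shows "\<bar>pdx u j x0 t0\<bar> \<le> 2 * M * ((32 + 8 * real CARD('n)) / R)"
proof -
  let ?n = "real CARD('n)"
  define A where "A = 32 + 8 * ?n"
  have A: "A \<ge> 32" by (simp add: A_def)
  have R0: "R > 0" using d R by simp
  \<comment> \<open>Subtracting from 2 M rather than M keeps w between M and 2 M, so ln w is defined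
    and oscillates by at most ln 2.\<close>
  define w where "w = (\<lambda>x t. 2 * M - u x t)"
  have kpos: "y $ k > 0" if "norm (y - x0) \<le> 3 * R / 2" for y
    using that component_le_norm_cart[of "y - x0" k] d by (simp add: R)
  have wM: "M \<le> w y t" "w y t \<le> 2 * M" "w y t > 0" if "norm (y - x0) \<le> 3 * R / 2" "t \<le> t0" for y t
    using uM[OF that] nonneg[of y t] kpos[OF that(1)] that t0 M by (auto simp: w_def)
  \<comment> \<open>The cutoff involves x and t only. It is not positive for |x - x0| = R or t = t0
    - R^2, and equals R^2 at (x0, t0), where \<Phi> \<le> 0 becomes a Lipschitz bound A / R for ln
    w. For y the larger ball is enough, since the penalty keeps y close to x.\<close>
  define \<zeta> where "\<zeta> = (\<lambda>(x::real^'n) t. R^2 - norm (x - x0)^2 - (t0 - t))"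
  define \<Phi> where "\<Phi> = (\<lambda>x y t. \<zeta> x t * (ln (w y t) - ln (w x t)) - A * R * norm (x - y))"
  have main: "\<Phi> x y t \<le> 0" if "norm (x - x0) \<le> R" "norm (y - x0) \<le> 3 * R / 2" "t0 - R^2 \<le> t" "t \<le> t0" "\<zeta> x t \<ge> 0" for x y t
  proof (rule ccontr)
    assume "\<not> ?thesis"
    then have pos0: "\<Phi> x y t > 0" by simp
    define S0 where "S0 = cball x0 R \<times> cball x0 (3 * R / 2) \<times> {t0 - R^2..t0}"
    define S where "S = S0 \<inter> {z. \<zeta> (fst z) (snd (snd z)) \<ge> 0}"
    have "closed {z :: (real^'n) \<times> (real^'n) \<times> real. \<zeta> (fst z) (snd (snd z)) \<ge> 0}"
      unfolding \<zeta>_def by (intro closed_Collect_le continuous_intros)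
    then have "compact S" unfolding S_def S0_def
      by (intro compact_Times compact_Icc compact_Int_closed compact_cball)
    moreover have "(x, y, t) \<in> S" using that by (simp add: S_def S0_def dist_norm norm_minus_commute)
    moreover have "continuous_on S (\<lambda>z. \<Phi> (fst z) (fst (snd z)) (snd (snd z)))"
    proof -
      have k0: "norm (fst z - x0) \<le> 3 * R / 2" "norm (fst (snd z) - x0) \<le> 3 * R / 2" "snd (snd z) \<le> t0" if "z \<in> S" for z
        using that R0 by (auto simp: S_def S0_def dist_norm norm_minus_commute)
      have k1: "0 \<le> fst z $ k \<and> snd (snd z) \<le> 0" "0 \<le> fst (snd z) $ k \<and> snd (snd z) \<le> 0" if "z \<in> S" for z
        using kpos[OF k0(1)[OF that]] kpos[OF k0(2)[OF that]] k0(3)[OF that] t0 by linarith+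
      have k2: "w (fst z) (snd (snd z)) \<noteq> 0" "w (fst (snd z)) (snd (snd z)) \<noteq> 0" if "z \<in> S" for z
        using wM(3)[OF k0(1)[OF that] k0(3)[OF that]] wM(3)[OF k0(2)[OF that] k0(3)[OF that]] by linarith+
      have cu: "continuous_on S (\<lambda>z. w (fst z) (snd (snd z)))" "continuous_on S (\<lambda>z. w (fst (snd z)) (snd (snd z)))"
        unfolding w_def by (intro continuous_intros cont_u_comp k1; assumption)+
      have l: "continuous_on S (\<lambda>z. ln (w (fst z) (snd (snd z))))" "continuous_on S (\<lambda>z. ln (w (fst (snd z)) (snd (snd z))))"
        by (intro continuous_on_ln cu ballI k2; assumption)+
      show ?thesis unfolding \<Phi>_def \<zeta>_def
        by (intro continuous_intros l)
    qed
    ultimately obtain z where z: "z \<in> S" "\<And>v. v \<in> S \<Longrightarrow> \<Phi> (fst v) (fst (snd v)) (snd (snd v)) \<le> \<Phi> (fst z) (fst (snd z)) (snd (snd z))"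
      using continuous_attains_sup[of S "\<lambda>z. \<Phi> (fst z) (fst (snd z)) (snd (snd z))"] by blast
    obtain X Y T where zx: "z = (X, Y, T)" using prod_cases3 by blast
    have mx: "\<Phi> X' Y' T' \<le> \<Phi> X Y T" if "norm (X' - x0) \<le> R" "norm (Y' - x0) \<le> 3 * R / 2" "t0 - R^2 \<le> T'" "T' \<le> t0" "\<zeta> X' T' \<ge> 0" for X' Y' T'
      using z(2)[of "(X', Y', T')"] that zx by (auto simp: S_def S0_def dist_norm norm_minus_commute)
    have XT: "norm (X - x0) \<le> R" "norm (Y - x0) \<le> 3 * R / 2" "t0 - R^2 \<le> T" "T \<le> t0" "\<zeta> X T \<ge> 0"
      using z(1) zx by (auto simp: S_def S0_def dist_norm norm_minus_commute)
    have \<Phi>pos: "\<Phi> X Y T > 0" using mx[of x y t] pos0 that by linarith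
    have XT': "norm (X - x0) \<le> 3 * R / 2" using XT(1) R0 by linarith
    have T0: "T < 0" using XT t0 by simp
    define L where "L = ln (w Y T) - ln (w X T)"
    define \<zeta>0 where "\<zeta>0 = \<zeta> X T"
    have \<Phi>eq: "\<Phi> X Y T = \<zeta>0 * L - A * R * norm (X - Y)" by (simp add: \<Phi>_def L_def \<zeta>0_def)
    have wX: "w X T > 0" "M \<le> w X T" "w X T \<le> 2 * M" and wY: "w Y T > 0" "M \<le> w Y T" "w Y T \<le> 2 * M"
      using wM[of X T] wM[of Y T] XT R0 by auto
    have \<zeta>R: "\<zeta>0 \<le> R^2" using XT(4) zero_le_power2[of "norm (X - x0)"]
      unfolding \<zeta>0_def \<zeta>_def by linarith
    have \<zeta>L: "\<zeta>0 * L > 0" using \<Phi>pos \<Phi>eq A R0 by (smt (verit) mult_nonneg_nonneg norm_ge_zero)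
    then have \<zeta>0: "\<zeta>0 > 0" and L0: "L > 0"
      using XT(5) by (auto simp: \<zeta>0_def[symmetric] zero_less_mult_iff)
    have L1: "L \<le> 1"
    proof -
      have "ln (w Y T) \<le> ln (2 * M)" using wY by simp
      moreover have "ln (w X T) \<ge> ln M" using wX M by simp
      ultimately have "L \<le> ln 2" using M by (simp add: L_def ln_mult)
      also have "\<dots> \<le> 1" using ln_le_minus_one[of 2] by simp
      finally show ?thesis .
    qed
    define r where "r = norm (X - Y)"
    have r0: "r > 0"
    proof (rule ccontr)
      assume "\<not> r > 0"
      then have "X = Y" by (simp add: r_def)
      then show False using L0 by (simp add: L_def)
    qed
    have XR: "norm (X - x0) < R"
    proof -
      have "norm (X - x0)^2 < R^2" using \<zeta>0 XT by (simp add: \<zeta>0_def \<zeta>_def)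
      then show ?thesis using R0 power2_less_imp_less by fastforce
    qed
    have TR: "t0 - R^2 < T"
      using \<zeta>0 unfolding \<zeta>0_def \<zeta>_def by (smt (verit) zero_le_power2)
    \<comment> \<open>A positive maximum forces A R r < \<zeta>0 L \<le> R^2, hence r < R / 32, well
      within the margin R / 2 between the two balls.\<close>
    have YR: "norm (Y - x0) < 3 * R / 2"
    proof -
      have "A * R * r < \<zeta>0 * L" using \<Phi>pos \<Phi>eq by (simp add: r_def)
      also have "\<dots> \<le> R^2 * 1" using \<zeta>R L1 L0 by (intro mult_mono) auto
      finally have "A * r < R" using R0 by (simp add: power2_eq_square)
      moreover have "32 * r \<le> A * r" using A r0 by (intro mult_right_mono) auto
      ultimately have "r < R / 2" using r0 by linarith
      moreover have "norm (Y - x0) \<le> r + norm (X - x0)"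
        unfolding r_def by (metis norm_minus_commute norm_diff_triangle_ineq diff_add_cancel dist_norm dist_triangle)
      ultimately show ?thesis using XR by linarith
    qed
    have Xk: "X $ k > 0" "Y $ k > 0" using kpos XT R0 by auto
    have \<zeta>shift: "\<zeta> (X + s *\<^sub>R axis i 1) T = \<zeta>0 - 2 * s * (X - x0) $ i - s^2" for s i
      unfolding \<zeta>_def \<zeta>0_def norm_sq_shift by simp
    obtain e where e: "e > 0" "e \<le> R - norm (X - x0)" "e \<le> 3 * R / 2 - norm (Y - x0)"
      and e\<zeta>: "\<And>s i. \<bar>s\<bar> < e \<Longrightarrow> \<zeta> (X + s *\<^sub>R axis i 1) T \<ge> 0"
    proof -
      define e where "e = min (min (R - norm (X - x0)) (3 * R / 2 - norm (Y - x0))) (\<zeta>0 / (3 * R))"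
      have "\<zeta> (X + s *\<^sub>R axis i 1) T \<ge> 0" if s: "\<bar>s\<bar> < e" for s i
      proof -
        have "\<bar>2 * s * (X - x0) $ i\<bar> \<le> 2 * \<bar>s\<bar> * R"
          using component_le_norm_cart[of "X - x0" i] XR unfolding abs_mult
          by (intro mult_mono) auto
        moreover have "s^2 \<le> \<bar>s\<bar> * R"
        proof -
          have "\<bar>s\<bar> < R - norm (X - x0)" using s by (simp add: e_def)
          then have "\<bar>s\<bar> \<le> R" using norm_ge_zero[of "X - x0"] by linarith
          then have "\<bar>s\<bar> * \<bar>s\<bar> \<le> \<bar>s\<bar> * R" by (intro mult_left_mono) auto
          then show ?thesis by (simp add: power2_eq_square)
        qed
        moreover have "\<bar>s\<bar> * (3 * R) \<le> \<zeta>0 / (3 * R) * (3 * R)"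
          using s R0 by (intro mult_right_mono) (auto simp: e_def)
        then have "3 * (\<bar>s\<bar> * R) \<le> \<zeta>0" using R0 by (simp add: mult_ac)
        ultimately show ?thesis unfolding \<zeta>shift by linarith
      qed
      moreover have "e > 0" using XR YR \<zeta>0 R0 by (simp add: e_def)
      ultimately show thesis by (intro that[of e]) (auto simp: e_def)
    qed
    have dl: "((\<lambda>s. ln (w (V + s *\<^sub>R axis i 1) T)) has_real_derivative
        - pdx u i (V + s *\<^sub>R axis i 1) T / w (V + s *\<^sub>R axis i 1) T) (at s)"
      if "norm (V + s *\<^sub>R axis i 1 - x0) \<le> 3 * R / 2" for V s i
    proof -
      have "((\<lambda>s. w (V + s *\<^sub>R axis i 1) T) has_real_derivative 0 - pdx u i (V + s *\<^sub>R axis i 1) T) (at s)"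
        unfolding w_def using kpos[OF that] T0 by (intro DERIV_diff DERIV_const pdx_has_derivative) auto
      moreover have "w (V + s *\<^sub>R axis i 1) T > 0" using wM(3)[OF that XT(4)] .
      ultimately show ?thesis
        by (intro DERIV_cong[OF DERIV_chain2[OF DERIV_ln]]) (auto simp: divide_inverse)
    qed
    have inX: "norm (X + s *\<^sub>R axis i 1 - x0) \<le> R" if "\<bar>s\<bar> < e" for s i
      using norm_shift_le[of X s i x0] that e by simp
    have inX': "norm (X + s *\<^sub>R axis i 1 - x0) \<le> 3 * R / 2" if "\<bar>s\<bar> < e" for s i
      using inX[OF that, of i] R0 by simp
    have inY: "norm (Y + s *\<^sub>R axis i 1 - x0) \<le> 3 * R / 2" if "\<bar>s\<bar> < e" for s i
      using norm_shift_le[of Y s i x0] that e by simp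
    have dlX: "((\<lambda>s. ln (w (X + s *\<^sub>R axis i 1) T)) has_real_derivative - pdx u i X T / w X T) (at 0)"
      and dlY: "((\<lambda>s. ln (w (Y + s *\<^sub>R axis i 1) T)) has_real_derivative - pdx u i Y T / w Y T) (at 0)" for i
      using dl[of X 0 i] dl[of Y 0 i] XT R0 by auto
    have dn: "((\<lambda>s. norm (V + s *\<^sub>R axis i 1 - V')) has_real_derivative (V - V') $ i / norm (V - V')) (at 0)"
      if "norm (V - V') > 0" for V V' :: "real^'n" and i
    proof -
      define c where "c = (V - V') $ i"
      have d: "((\<lambda>s. norm (V - V')^2 + 2 * s * c + s^2) has_real_derivative 2 * c) (at 0)"
        by (auto intro!: derivative_eq_intros)
      have "((\<lambda>s. sqrt (norm (V - V')^2 + 2 * s * c + s^2)) has_real_derivative c / norm (V - V')) (at 0)"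
        by (rule DERIV_cong[OF DERIV_chain2[OF DERIV_real_sqrt d]]) (use that in \<open>auto simp: field_simps\<close>)
      then have "((\<lambda>s. sqrt (norm (V + s *\<^sub>R axis i 1 - V')^2)) has_real_derivative (V - V') $ i / norm (V - V')) (at 0)"
        unfolding norm_sq_shift c_def .
      then show ?thesis by simp
    qed
    define qX where "qX = (1 / w X T) *\<^sub>R sgrad u X T"
    define qY where "qY = (1 / w Y T) *\<^sub>R sgrad u Y T"
    define \<xi> where "\<xi> = A * R / \<zeta>0"
    have div\<zeta>: "a = b / \<zeta>0" if "\<zeta>0 * a = b" for a b using that \<zeta>0 by auto
    have gY: "qY $ i = \<xi> * (X - Y) $ i / r" for i
    proof -
      let ?f = "\<lambda>s. \<Phi> X (Y + s *\<^sub>R axis i 1) T"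
      have f: "?f = (\<lambda>s. \<zeta>0 * (ln (w (Y + s *\<^sub>R axis i 1) T) - ln (w X T)) - A * R * norm (Y + s *\<^sub>R axis i 1 - X))"
        unfolding \<Phi>_def \<zeta>0_def by (simp add: norm_minus_commute)
      have "(?f has_real_derivative \<zeta>0 * (- pdx u i Y T / w Y T - 0) - A * R * ((Y - X) $ i / norm (Y - X))) (at 0)"
        unfolding f using r0 by (intro DERIV_diff DERIV_cmult DERIV_const dlY dn) (simp add: r_def norm_minus_commute)
      then have "\<zeta>0 * (- pdx u i Y T / w Y T - 0) - A * R * ((Y - X) $ i / norm (Y - X)) = 0"
        by (rule critical_point[OF _ e(1)]) (use mx[of X "Y + s *\<^sub>R axis i 1" T for s] inY XT in simp)
      then have "\<zeta>0 * (pdx u i Y T / w Y T) = A * R * ((X - Y) $ i / r)"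
        unfolding r_def norm_minus_commute[of X Y] by (simp add: algebra_simps diff_divide_distrib)
      then have "pdx u i Y T / w Y T = A * R * ((X - Y) $ i / r) / \<zeta>0" by (rule div\<zeta>)
      then show ?thesis by (simp add: qY_def sgrad_def \<xi>_def)
    qed
    \<comment> \<open>The cutoff depends on X but not on Y, and its derivative is the only
      difference between the two gradients.\<close>
    have gX: "qX $ i = qY $ i + 2 * L / \<zeta>0 * (X - x0) $ i" for i
    proof -
      let ?f = "\<lambda>s. \<Phi> (X + s *\<^sub>R axis i 1) Y T"
      have f: "?f = (\<lambda>s. (\<zeta>0 - 2 * s * (X - x0) $ i - s^2) * (ln (w Y T) - ln (w (X + s *\<^sub>R axis i 1) T)) - A * R * norm (X + s *\<^sub>R axis i 1 - Y))"
        unfolding \<Phi>_def \<zeta>shift ..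
      have z: "((\<lambda>s. \<zeta>0 - 2 * s * (X - x0) $ i - s^2) has_real_derivative - 2 * (X - x0) $ i) (at 0)"
        by (auto intro!: derivative_eq_intros)
      have "(?f has_real_derivative - 2 * (X - x0) $ i * (ln (w Y T) - ln (w (X + 0 *\<^sub>R axis i 1) T))
           + (0 - (- pdx u i X T / w X T)) * (\<zeta>0 - 2 * 0 * (X - x0) $ i - 0^2) - A * R * ((X - Y) $ i / norm (X - Y))) (at 0)"
        unfolding f using r0 by (intro DERIV_diff DERIV_mult DERIV_cmult[of _ _ _ _ "A * R"] DERIV_const dlX dn z) (simp add: r_def)
      then have "- 2 * (X - x0) $ i * (ln (w Y T) - ln (w (X + 0 *\<^sub>R axis i 1) T))
           + (0 - (- pdx u i X T / w X T)) * (\<zeta>0 - 2 * 0 * (X - x0) $ i - 0^2) - A * R * ((X - Y) $ i / norm (X - Y)) = 0"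
        by (rule critical_point[OF _ e(1)]) (use mx[of "X + s *\<^sub>R axis i 1" Y T for s] inX e\<zeta> XT in simp)
      then have "\<zeta>0 * (pdx u i X T / w X T) = A * R * ((X - Y) $ i / r) + 2 * L * (X - x0) $ i"
        unfolding r_def L_def by (simp add: algebra_simps)
      then have "pdx u i X T / w X T = (A * R * ((X - Y) $ i / r) + 2 * L * (X - x0) $ i) / \<zeta>0"
        by (rule div\<zeta>)
      then show ?thesis unfolding gY by (simp add: qX_def sgrad_def \<xi>_def add_divide_distrib)
    qed
    define DX where "DX = (\<lambda>i. pdx (pdx u i) i X T / w X T + (qX $ i)^2)"
    define DY where "DY = (\<lambda>i. pdx (pdx u i) i Y T / w Y T + (qY $ i)^2)"
    \<comment> \<open>The terms are those of \<zeta>'' l + 2 \<zeta>' l' + \<zeta> l'' with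
      \<open>l\<close> the difference of logarithms along the common shift; \<open>gX\<close>
      identifies l' at 0, which yields the term with 8 L.\<close>
    have sp: "- 2 * L - 8 * L * ((X - x0) $ i)^2 / \<zeta>0 + \<zeta>0 * (DX i - DY i) \<le> 0" for i
    proof -
      define c where "c = (X - x0) $ i"
      define l where "l = (\<lambda>s. ln (w (Y + s *\<^sub>R axis i 1) T) - ln (w (X + s *\<^sub>R axis i 1) T))"
      define l' where "l' = (\<lambda>s. - pdx u i (Y + s *\<^sub>R axis i 1) T / w (Y + s *\<^sub>R axis i 1) T
          - (- pdx u i (X + s *\<^sub>R axis i 1) T / w (X + s *\<^sub>R axis i 1) T))"
      have l1: "(l has_real_derivative l' s) (at s)" if "\<bar>s\<bar> < e" for s
        unfolding l_def l'_def using inX' inY that by (intro DERIV_diff dl) auto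
      have dq: "((\<lambda>s. - pdx u i (V + s *\<^sub>R axis i 1) T / w (V + s *\<^sub>R axis i 1) T) has_real_derivative
          - (pdx (pdx u i) i V T / w V T + (((1 / w V T) *\<^sub>R sgrad u V T) $ i)^2)) (at 0)"
        if "norm (V - x0) \<le> 3 * R / 2" for V
      proof -
        have V: "V $ k > 0" "w V T > 0" using kpos[OF that] wM(3)[OF that] XT by auto
        have 1: "((\<lambda>s. w (V + s *\<^sub>R axis i 1) T) has_real_derivative 0 - pdx u i V T) (at 0)"
          unfolding w_def using V T0 by (intro DERIV_diff DERIV_const pdx_has_derivative_0) auto
        have "((\<lambda>s. - pdx u i (V + s *\<^sub>R axis i 1) T / w (V + s *\<^sub>R axis i 1) T) has_real_derivative
           (- pdx (pdx u i) i V T * w (V + 0 *\<^sub>R axis i 1) T - (- pdx u i (V + 0 *\<^sub>R axis i 1) T) * (0 - pdx u i V T))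
            / (w (V + 0 *\<^sub>R axis i 1) T * w (V + 0 *\<^sub>R axis i 1) T)) (at 0)"
          by (intro DERIV_divide DERIV_minus pdx_pdx_has_derivative 1) (use V T0 in auto)
        then show ?thesis
          using V by (simp add: sgrad_def diff_divide_distrib power2_eq_square)
      qed
      have l2: "(l' has_real_derivative DX i - DY i) (at 0)"
      proof -
        have "(l' has_real_derivative - DY i - - DX i) (at 0)"
          unfolding l'_def DX_def DY_def qX_def qY_def by (intro DERIV_diff dq XT(2) XT')
        then show ?thesis by simp
      qed
      let ?f = "\<lambda>s. \<Phi> (X + s *\<^sub>R axis i 1) (Y + s *\<^sub>R axis i 1) T"
      let ?f' = "\<lambda>s. (- 2 * c - 2 * s) * l s + l' s * (\<zeta>0 - 2 * s * c - s^2)"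
      have f: "?f = (\<lambda>s. (\<zeta>0 - 2 * s * c - s^2) * l s - A * R * norm (X - Y))"
        unfolding \<Phi>_def \<zeta>shift c_def l_def by simp
      have z: "((\<lambda>s. \<zeta>0 - 2 * s * c - s^2) has_real_derivative - 2 * c - 2 * s) (at s)" for s
        by (auto intro!: derivative_eq_intros)
      have z2: "((\<lambda>s. - 2 * c - 2 * s) has_real_derivative - 2) (at 0)"
        by (auto intro!: derivative_eq_intros)
      have 1: "(?f has_real_derivative ?f' s) (at s)" if s: "\<bar>s\<bar> < e" for s
        unfolding f by (rule DERIV_cong, (rule z l1[OF s] DERIV_diff DERIV_mult DERIV_const)+) simp
      have e0: "\<bar>0\<bar> < e" using e by simp
      have l0: "l 0 = L" "l' 0 = 2 * L / \<zeta>0 * c"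
        using gX[of i] by (auto simp: l_def L_def l'_def qX_def qY_def sgrad_def c_def)
      have 2: "(?f' has_real_derivative (- 2 * L - 8 * L * c^2 / \<zeta>0 + \<zeta>0 * (DX i - DY i))) (at 0)"
        by (rule DERIV_cong, (rule z z2 l1[OF e0] l2 DERIV_add DERIV_mult)+)
          (simp add: l0 power2_eq_square algebra_simps)
      have 3: "?f s \<le> ?f 0" if "\<bar>s\<bar> < e" for s
        using mx[of "X + s *\<^sub>R axis i 1" "Y + s *\<^sub>R axis i 1" T] inX[OF that] inY[OF that] e\<zeta>[OF that] XT by simp
      have "- 2 * L - 8 * L * c^2 / \<zeta>0 + \<zeta>0 * (DX i - DY i) \<le> 0"
        by (rule second_derivative_test(2)[OF e(1) 1 2 3])
      then show ?thesis by (simp add: c_def)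
    qed
    have tm: "L + \<zeta>0 * (pdt u X T / w X T - pdt u Y T / w Y T) \<ge> 0"
    proof (rule left_derivative_test[of "\<lambda>s. \<Phi> X Y s"])
      have dlt: "((\<lambda>s. ln (w V s)) has_real_derivative - pdt u V T / w V T) (at T)"
        if "norm (V - x0) \<le> 3 * R / 2" for V
      proof -
        have V: "V $ k > 0" "w V T > 0" using kpos[OF that] wM(3)[OF that] XT by auto
        have "((\<lambda>s. w V s) has_real_derivative 0 - pdt u V T) (at T)"
          unfolding w_def using V T0 by (intro DERIV_diff DERIV_const pdt_has_derivative) auto
        then show ?thesis
          using V(2) by (intro DERIV_cong[OF DERIV_chain2[OF DERIV_ln]]) (auto simp: divide_inverse)
      qed
      have z: "((\<lambda>s. \<zeta> X s) has_real_derivative 1) (at T)"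
        unfolding \<zeta>_def by (auto intro!: derivative_eq_intros)
      have "((\<lambda>s. \<Phi> X Y s) has_real_derivative 1 * (ln (w Y T) - ln (w X T)) +
         (- pdt u Y T / w Y T - - pdt u X T / w X T) * \<zeta> X T - 0) (at T)"
        unfolding \<Phi>_def by (intro DERIV_diff DERIV_mult DERIV_const dlt z XT(2) XT')
      then show "((\<lambda>s. \<Phi> X Y s) has_real_derivative L + \<zeta>0 * (pdt u X T / w X T - pdt u Y T / w Y T)) (at T)"
        by (simp add: L_def \<zeta>0_def algebra_simps)
      \<comment> \<open>Earlier times are admissible only while \<zeta> X s \<ge> 0, that is for s
        \<ge> T - \<zeta>0.\<close>
      show "max (t0 - R^2) (T - \<zeta>0) < T" using TR \<zeta>0 by simp
      fix s assume s: "max (t0 - R^2) (T - \<zeta>0) < s" "s < T"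
      then have "t0 - R^2 < s" "T - \<zeta>0 < s" by simp_all
      moreover have "\<zeta> X s = \<zeta>0 - (T - s)" by (simp add: \<zeta>0_def \<zeta>_def)
      ultimately show "\<Phi> X Y s \<le> \<Phi> X Y T"
        using XT(1,2,4) s(2) by (intro mx) auto
    qed
    \<comment> \<open>The equation divided by w, written with the gradient q of -ln w; the squares
      |q|^2 missing here are contained in \<open>DX\<close> and \<open>DY\<close>.\<close>
    have pdew: "pdt u V T / w V T - slap u V T / w V T = w V T powr (p - 1) * norm ((1 / w V T) *\<^sub>R sgrad u V T) powr p"
      if "V $ k > 0" "w V T > 0" for V
    proof -
      have "pdt u V T / w V T - slap u V T / w V T = norm (sgrad u V T) powr p / w V T"
        using pde[OF that(1) T0] by (simp add: diff_divide_distrib[symmetric])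
      moreover have "norm (sgrad u V T) = w V T * norm ((1 / w V T) *\<^sub>R sgrad u V T)" using that by simp
      then have "norm (sgrad u V T) powr p = w V T powr p * norm ((1 / w V T) *\<^sub>R sgrad u V T) powr p"
        using that by (metis powr_mult)
      moreover have "w V T powr (p - 1) = w V T powr p / w V T" using that by (simp add: powr_diff)
      ultimately show ?thesis by simp
    qed
    have "(\<Sum>i\<in>UNIV. - 2 * L - 8 * L * ((X - x0) $ i)^2 / \<zeta>0 + \<zeta>0 * (DX i - DY i)) \<le> 0"
      using sp by (intro sum_nonpos) blast
    also have "(\<Sum>i\<in>UNIV. - 2 * L - 8 * L * ((X - x0) $ i)^2 / \<zeta>0 + \<zeta>0 * (DX i - DY i))
       = - 2 * ?n * L - 8 * L * norm (X - x0)^2 / \<zeta>0 + \<zeta>0 * (slap u X T / w X T + norm qX^2 - (slap u Y T / w Y T + norm qY^2))"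
    proof -
      have "(\<Sum>i\<in>UNIV. DX i) = slap u X T / w X T + norm qX^2" "(\<Sum>i\<in>UNIV. DY i) = slap u Y T / w Y T + norm qY^2"
        by (simp_all add: DX_def DY_def sum.distrib slap_def norm_sq_sum sum_divide_distrib)
      moreover have "(\<Sum>i\<in>UNIV. - 2 * L - 8 * L * ((X - x0) $ i)^2 / \<zeta>0 + \<zeta>0 * (DX i - DY i))
        = - 2 * ?n * L - 8 * L * (\<Sum>i\<in>UNIV. ((X - x0) $ i)^2) / \<zeta>0 + \<zeta>0 * ((\<Sum>i\<in>UNIV. DX i) - (\<Sum>i\<in>UNIV. DY i))"
        by (simp add: sum_subtractf sum.distrib sum_distrib_left sum_divide_distrib right_diff_distrib del: vector_minus_component)
      ultimately show ?thesis unfolding norm_sq_sum[of "X - x0"] by simp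
    qed
    finally have sl: "- 2 * ?n * L - 8 * L * norm (X - x0)^2 / \<zeta>0
        + \<zeta>0 * (slap u X T / w X T + norm qX^2 - (slap u Y T / w Y T + norm qY^2)) \<le> 0" .
    have "0 \<le> \<zeta>0 * (w X T powr (p - 1) * norm qX powr p - w Y T powr (p - 1) * norm qY powr p - norm qX^2 + norm qY^2)
        + (2 * ?n + 1) * L + 8 * L * norm (X - x0)^2 / \<zeta>0"
      using sl tm unfolding qX_def qY_def pdew[OF Xk(1) wX(1), symmetric] pdew[OF Xk(2) wY(1), symmetric]
      by (simp add: algebra_simps)
    also have "\<dots> \<le> \<zeta>0 * (w X T powr (p - 1) * norm qX powr p - w Y T powr (p - 1) * norm qY powr p - norm qX^2 + norm qY^2)
        + (2 * ?n + 1) * L + 8 * L * R^2 / \<zeta>0"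
      using XR L0 \<zeta>0 by (intro add_left_mono divide_right_mono mult_left_mono power_mono) auto
    finally have ge0: "0 \<le> \<zeta>0 * (w X T powr (p - 1) * norm qX powr p - w Y T powr (p - 1) * norm qY powr p - norm qX^2 + norm qY^2)
        + (2 * ?n + 1) * L + 8 * L * R^2 / \<zeta>0" .
    have \<xi>0: "\<xi> > 0" using A R0 \<zeta>0 by (simp add: \<xi>_def)
    have nY: "norm qY = \<xi>"
    proof -
      have "qY = (\<xi> / r) *\<^sub>R (X - Y)" unfolding vec_eq_iff using gY by simp
      then show ?thesis using \<xi>0 r0 by (simp add: r_def)
    qed
    have nX: "qX = qY + (2 * L / \<zeta>0) *\<^sub>R (X - x0)" unfolding vec_eq_iff using gX by simp
    have nc: "norm ((2 * L / \<zeta>0) *\<^sub>R (X - x0)) \<le> 2 * L * R / \<zeta>0"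
    proof -
      have "2 * L / \<zeta>0 * norm (X - x0) \<le> 2 * L / \<zeta>0 * R" using XR L0 \<zeta>0 by (intro mult_left_mono) auto
      then show ?thesis using L0 \<zeta>0 by simp
    qed
    have "w X T = w Y T * exp (- L)"
      using wX wY by (simp add: L_def exp_diff)
    moreover have "norm qX \<le> \<xi> + 2 * L * R / \<zeta>0"
      using norm_triangle_ineq[of qY "(2 * L / \<zeta>0) *\<^sub>R (X - x0)"] nc nY unfolding nX by linarith
    moreover have "\<xi> - 2 * L * R / \<zeta>0 \<le> norm qX"
      using norm_diff_ineq[of qY "(2 * L / \<zeta>0) *\<^sub>R (X - x0)"] nc nY unfolding nX by linarith
    moreover have "\<xi> * \<zeta>0 = A * R" using \<zeta>0 by (simp add: \<xi>_def)
    ultimately show False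
      using doubling_core[OF p2 R0 \<zeta>0 \<zeta>R _ A_def _ L0 L1 M wY(2) _ MR, of \<xi> "w X T" "norm qX"] ge0
      unfolding nY by simp
  qed
  define D where "D = - pdx u j x0 t0 / w x0 t0"
  have w0: "w x0 t0 > 0" "w x0 t0 \<le> 2 * M" using wM[of x0 t0] R0 by auto
  have D: "((\<lambda>s. ln (w (x0 + s *\<^sub>R axis j 1) t0)) has_real_derivative D) (at 0)"
  proof -
    have "((\<lambda>s. w (x0 + s *\<^sub>R axis j 1) t0) has_real_derivative 0 - pdx u j x0 t0) (at 0)"
      unfolding w_def using d t0 by (intro DERIV_diff DERIV_const pdx_has_derivative_0) auto
    then show ?thesis
      unfolding D_def using w0(1) by (intro DERIV_cong[OF DERIV_chain2[OF DERIV_ln]]) (auto simp: divide_inverse)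
  qed
  have lip: "ln (w (x0 + s *\<^sub>R axis j 1) t0) - ln (w x0 t0) \<le> A / R * \<bar>s\<bar>" if "\<bar>s\<bar> \<le> R" for s
  proof -
    have "\<Phi> x0 (x0 + s *\<^sub>R axis j 1) t0 \<le> 0"
      using that R0 by (intro main) (auto simp: \<zeta>_def)
    define q where "q = ln (w (x0 + s *\<^sub>R axis j 1) t0) - ln (w x0 t0)"
    have "R * (R * q) \<le> R * (A * \<bar>s\<bar>)"
      using \<open>\<Phi> _ _ _ \<le> 0\<close> unfolding \<Phi>_def q_def[symmetric]
      by (simp add: \<zeta>_def power2_eq_square algebra_simps)
    then have "R * q \<le> A * \<bar>s\<bar>" using R0 mult_le_cancel_left_pos by blast
    then have "q \<le> A / R * \<bar>s\<bar>" using R0 by (simp add: field_simps)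
    then show ?thesis unfolding q_def .
  qed
  have lim: "((\<lambda>s. (ln (w (x0 + s *\<^sub>R axis j 1) t0) - ln (w x0 t0)) / s) \<longlongrightarrow> D) (at 0)"
    using D by (simp add: has_field_derivative_iff)
  have "D \<le> A / R"
  proof (rule tendsto_upperbound)
    show "((\<lambda>s. (ln (w (x0 + s *\<^sub>R axis j 1) t0) - ln (w x0 t0)) / s) \<longlongrightarrow> D) (at_right 0)"
      using lim by (simp add: filterlim_at_split)
    have "eventually (\<lambda>q. q < R) (at_right (0::real))" using R0 by (intro order_tendstoD) auto
    moreover have "eventually (\<lambda>q. q > 0) (at_right (0::real))" by (simp add: eventually_at_right_less)
    ultimately show "eventually (\<lambda>s. (ln (w (x0 + s *\<^sub>R axis j 1) t0) - ln (w x0 t0)) / s \<le> A / R) (at_right 0)"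
    proof eventually_elim
      case (elim s)
      then show ?case using lip[of s] by (simp add: pos_divide_le_eq)
    qed
  qed simp
  moreover have "- (A / R) \<le> D"
  proof (rule tendsto_lowerbound)
    show "((\<lambda>s. (ln (w (x0 + s *\<^sub>R axis j 1) t0) - ln (w x0 t0)) / s) \<longlongrightarrow> D) (at_left 0)"
      using lim by (simp add: filterlim_at_split)
    have "eventually (\<lambda>q. q > - R) (at_left (0::real))" using R0 by (intro order_tendstoD) auto
    moreover have "eventually (\<lambda>q. q < 0) (at_left (0::real))" by (simp add: eventually_at_filter)
    ultimately show "eventually (\<lambda>s. - (A / R) \<le> (ln (w (x0 + s *\<^sub>R axis j 1) t0) - ln (w x0 t0)) / s) (at_left 0)"
    proof eventually_elim
      case (elim s)
      then show ?case using lip[of s] by (simp add: neg_le_divide_eq)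
    qed
  qed simp
  ultimately have "\<bar>D\<bar> \<le> A / R" by linarith
  then have "w x0 t0 * \<bar>D\<bar> \<le> 2 * M * (A / R)" using w0 A R0 by (intro mult_mono) auto
  moreover have "w x0 t0 * \<bar>D\<bar> = \<bar>pdx u j x0 t0\<bar>" using w0 by (simp add: D_def abs_mult)
  ultimately show ?thesis by (simp add: A_def)
qed

end

section \<open>Both estimates with a constant uniform in the solution\<close>

theorem theorem2p6:
  fixes k :: "'n::finite" and p :: real
  assumes "p \<ge> 2"
  shows "(\<forall>u. ancient_solution k p u \<longrightarrow> (\<forall>(x,t)\<in>halfQ k. u x t \<ge> 0)) \<and>
         (p > 2 \<longrightarrow>
           (\<exists>C>0. \<forall>u. ancient_solution k p u \<longrightarrow>
              (\<forall>(x,t)\<in>halfQ k.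
                 u x t \<le> C * ((x $ k) powr (1 - 1/(p-1))
                               + (x $ k) powr (1 + 1/(p-1)) * \<bar>t\<bar> powr (-(1/(p-1)))) \<and>
                 norm (sgrad u x t) \<le> C * ((x $ k) powr (-(1/(p-1)))
                               + (x $ k) powr (1/(p-1)) * \<bar>t\<bar> powr (-(1/(p-1)))))))"
proof (intro conjI allI impI)
  fix u assume "ancient_solution k p u"
  then interpret ancient k p u using assms by unfold_locales
  show "\<forall>(x,t)\<in>halfQ k. u x t \<ge> 0" using nonneg by (auto simp: halfQ_def)
next
  assume p: "p > 2"
  define \<beta> where "\<beta> = 1 / (p - 1)"
  have \<beta>: "0 < \<beta>" "\<beta> < 1" using p by (auto simp: \<beta>_def)
  have bp: "(p - 1) * (1 - \<beta>) = p - 2" using p by (simp add: \<beta>_def field_simps)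
  let ?n = "real CARD('n)"
  obtain a b where a: "a > 0" and b: "b > 0" and ok: "barrier_ok k p \<beta> a b"
    using barrier_ok_exists[OF p \<beta>_def, of k] by blast
  define c where "c = 2 * a * (1 + b) powr ((1 + \<beta>) / 2) + 1 / (1 - \<beta>)"
  have c: "c \<ge> 1"
  proof -
    have "1 \<le> 1 / (1 - \<beta>)" using \<beta> by simp
    moreover have "2 * a * (1 + b) powr ((1 + \<beta>) / 2) \<ge> 0" using a by simp
    ultimately show ?thesis unfolding c_def by linarith
  qed
  \<comment> \<open>Each of the n partial derivatives is at most 2 M (32 + 8 n) / (d/2) with M = 4 c
    B, that is 16 (32 + 8 n) c B / d. The summand 1 ensures c \<le> C for the bound on
    \<open>u\<close> itself.\<close>
  define C where "C = c * (16 * ?n * (32 + 8 * ?n) + 1)"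
  have cC: "c \<le> C" "C > 0"
  proof -
    have "c * 1 \<le> C" unfolding C_def using c by (intro mult_left_mono) auto
    then show "c \<le> C" "C > 0" using c by auto
  qed
  have "u x t \<le> C * ((x $ k) powr (1 - \<beta>) + (x $ k) powr (1 + \<beta>) * \<bar>t\<bar> powr (- \<beta>)) \<and>
     norm (sgrad u x t) \<le> C * ((x $ k) powr (- \<beta>) + (x $ k) powr \<beta> * \<bar>t\<bar> powr (- \<beta>))"
    if sol: "ancient_solution k p u" and xt: "(x, t) \<in> halfQ k" for u x t
  proof
    interpret ancient k p u using sol assms by unfold_locales
    define B where "B = (\<lambda>d s. d powr (1 - \<beta>) + d powr (1 + \<beta>) * \<bar>s\<bar> powr (- \<beta>) :: real)"
    have ub: "u y s \<le> c * B (y $ k) s" if "y $ k > 0" "s < 0" for y s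
      unfolding c_def B_def using that by (rule upper_bound[OF \<beta> a b ok])
    define d where "d = x $ k"
    have d: "d > 0" and t: "t < 0" using xt by (auto simp: halfQ_def d_def)
    have B0: "B d t > 0" using d t by (simp add: B_def add_pos_nonneg)
    have "u x t \<le> c * B d t" using ub d t unfolding d_def by blast
    also have "\<dots> \<le> C * B d t" using cC B0 by (intro mult_right_mono) auto
    finally show "u x t \<le> C * ((x $ k) powr (1 - \<beta>) + (x $ k) powr (1 + \<beta>) * \<bar>t\<bar> powr (- \<beta>))"
      by (simp add: B_def d_def)
    \<comment> \<open>Points within distance 3 d / 4 have height at most 2 d, and 2^q \<le> 4 for
      both exponents q = 1 - \<beta> and q = 1 + \<beta>; going back in time only decreases
      |s|^(-\<beta>).\<close>
    define M where "M = 4 * c * B d t"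
    have M: "M > 0" using c B0 by (simp add: M_def)
    have uM: "u y s \<le> M" if y: "norm (y - x) \<le> 3 * (d / 2) / 2" and s: "s \<le> t" for y s
    proof -
      have yk: "y $ k > 0" "y $ k \<le> 2 * d"
        using y component_le_norm_cart[of "y - x" k] d by (auto simp: d_def)
      have st: "\<bar>s\<bar> powr (- \<beta>) \<le> \<bar>t\<bar> powr (- \<beta>)" using s t \<beta> by (intro powr_mono2') auto
      have "(y $ k) powr q \<le> 4 * d powr q" if "0 \<le> q" "q \<le> 2" for q
      proof -
        have "(y $ k) powr q \<le> (2 * d) powr q" using yk that by (intro powr_mono2) auto
        also have "\<dots> = 2 powr q * d powr q" using d by (simp add: powr_mult)
        also have "\<dots> \<le> 2 powr 2 * d powr q" using that by (intro mult_right_mono powr_mono) auto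
        finally show ?thesis by simp
      qed
      then have "B (y $ k) s \<le> 4 * d powr (1 - \<beta>) + 4 * d powr (1 + \<beta>) * \<bar>t\<bar> powr (- \<beta>)"
        unfolding B_def using \<beta> st by (intro add_mono mult_mono) auto
      also have "\<dots> = 4 * B d t" by (simp add: B_def)
      finally have "c * B (y $ k) s \<le> c * (4 * B d t)" using c by (intro mult_left_mono) auto
      then show ?thesis using ub[OF yk(1), of s] s t by (simp add: M_def)
    qed
    \<comment> \<open>M dominates d^(1-\<beta>) because c \<ge> 1, and (1 - \<beta>) (p - 1) = p - 2
      turns this into the scaling that \<open>pdx_bound\<close> asks for.\<close>
    have MR: "(d / 2) powr (p - 2) \<le> M powr (p - 1)"
    proof -
      have "d powr (1 - \<beta>) \<le> B d t" by (simp add: B_def)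
      also have "1 * B d t \<le> (4 * c) * B d t" using c B0 by (intro mult_right_mono) auto
      finally have "(d powr (1 - \<beta>)) powr (p - 1) \<le> M powr (p - 1)"
        using p by (intro powr_mono2) (auto simp: M_def)
      moreover have "(d powr (1 - \<beta>)) powr (p - 1) = d powr (p - 2)"
        unfolding powr_powr by (subst mult.commute) (simp add: bp)
      moreover have "(d / 2) powr (p - 2) \<le> d powr (p - 2)" using d p by (intro powr_mono2) auto
      ultimately show ?thesis by linarith
    qed
    let ?K = "2 * M * ((32 + 8 * ?n) / (d / 2))"
    have pd: "\<bar>pdx u j x t\<bar> \<le> ?K" for j
    proof (rule pdx_bound[where R = "d / 2"])
      show "x $ k > 0" "t < 0" "d / 2 = x $ k / 2" "M > 0" using d t M by (auto simp: d_def)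
    qed (use uM MR in auto)
    have "norm (sgrad u x t) \<le> (\<Sum>j\<in>UNIV. \<bar>sgrad u x t $ j\<bar>)" by (rule norm_le_l1_cart)
    also have "\<dots> \<le> (\<Sum>j\<in>(UNIV::'n set). ?K)" using pd by (intro sum_mono) (simp add: sgrad_def)
    also have "\<dots> = 16 * ?n * (32 + 8 * ?n) * c * (B d t / d)" by (simp add: M_def)
    also have "\<dots> \<le> C * (B d t / d)"
      unfolding C_def using c B0 d by (intro mult_right_mono) (auto simp: algebra_simps)
    also have "B d t / d = d powr (- \<beta>) + d powr \<beta> * \<bar>t\<bar> powr (- \<beta>)"
    proof -
      have "d powr (1 - \<beta>) = d * d powr (- \<beta>)" "d powr (1 + \<beta>) = d * d powr \<beta>"
        using d powr_add[of d 1 "- \<beta>"] powr_add[of d 1 \<beta>] by auto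
      then show ?thesis using d by (simp add: B_def add_divide_distrib)
    qed
    finally show "norm (sgrad u x t) \<le> C * ((x $ k) powr (- \<beta>) + (x $ k) powr \<beta> * \<bar>t\<bar> powr (- \<beta>))"
      by (simp add: d_def)
  qed
  then show "\<exists>C>0. \<forall>u. ancient_solution k p u \<longrightarrow>
              (\<forall>(x,t)\<in>halfQ k.
                 u x t \<le> C * ((x $ k) powr (1 - 1/(p-1))
                               + (x $ k) powr (1 + 1/(p-1)) * \<bar>t\<bar> powr (-(1/(p-1)))) \<and>
                 norm (sgrad u x t) \<le> C * ((x $ k) powr (-(1/(p-1)))
                               + (x $ k) powr (1/(p-1)) * \<bar>t\<bar> powr (-(1/(p-1)))))"
    unfolding \<beta>_def using cC(2) by blast
qed

end
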